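(* Let $p,q$ be positive integers, and let $\mathcal{G}$ (coarse propagator) and $\mathcal{F}$ (fine propagator) satisfy the following conditions, for all $v,w,\xi\in V_h$ and all $0\le n\le N-1$, with hidden constants that are positive and independent of $h$, $\Delta t$, $\Delta T$, $v$, $w$, $\xi$: 1. $\max_{0\le n\le N-1}\|\mathcal{F}^M(v;T_n,T_{n+1})-\mathcal{H}(v;T_n,T_{n+1})\|_0\lesssim(\Delta t)^{q+1}$; 2. $\max_{0\le n\le N-1}\|\mathcal{G}(v;T_n,T_{n+1})-\mathcal{H}(v;T_n,T_{n+1})\|_0\lesssim(\Delta T)^{p+1}$; 3. $\|\mathcal{G}(v;T_n,T_{n+1})-\mathcal{G}(w;T_n,T_{n+1})\|_0-\|v-w\|_0\lesssim\Delta T\|v-w\|_0$ and $$\|\mathcal{G}(v;T_n,T_{n+1})-\mathcal{G}(w;T_n,T_{n+1})+\mathcal{H}(w;T_n,T_{n+1})-\mathcal{H}(\xi;T_n,T_{n+1})\|_0-\|v-\xi\|_0\lesssim\Delta T\|v-\xi\|_0+(\Delta T)^{p+1}\|w-\xi\|_0.$$ Then the numerical solution $\{U_h^{n,(k)}\}$ produced by the Parareal algorithm satisfies $$\|U_h^{n,(k)}-u_h(T_n)\|_0\lesssim(\Delta t)^q,\qquad 0\le n\le N,$$ when $k\ge N$, where the hidden constant is independent of $h$, $\Delta t$ and $\Delta T$.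
   Context: **Setting.** $\Omega\subset\mathbb{R}^d$ ($d\ge1$) is an open bounded rectangular domain (a product of intervals), $0<T<\infty$, $\mathcal{D}>0$ is a constant, $u_0\in H^2(\Omega)\cap H_0^1(\Omega)$, and one considers $u_t=\mathcal{D}\Delta u+f(t)$ in $\Omega$, $t_0\le t\le t_0+T$, $u(t_0)=u_0$, $u=0$ on $\partial\Omega$, with $f(t)=f(t,\cdot)$. **Norms and constants.** $\|\cdot\|_0$ is the $L^2(\Omega)$-norm, $(\cdot,\cdot)$ the $L^2(\Omega)$ inner product. $a\lesssim b$ means $a\le Cb$ with a constant $C>0$ independent of the mesh size $h$; $a\eqsim b$ means $a\lesssim b\lesssim a$. **Space discretization.** $\Omega$ is divided uniformly with mesh size $h_i>0$ in direction $x_i$, $h=\max_ih_i$, with $h\eqsim h_i$ for all $i$. $V_h\subset H_0^1(\Omega)$ is the span of the tensor products $\phi_1^{i_1}(x_1)\cdots\phi_d^{i_d}(x_d)$ of the one-dimensional continuous piecewise linear nodal basis functions vanishing at the endpoints. $P_h:L^2(\Omega)\to V_h$ is the $L^2$-orthogonal projection, and $L_h:V_h\to V_h$ is defined by $(L_hw_h,v_h)=\int_\Omega\mathcal{D}\nabla w_h\cdot\nabla v_h\,dx$ for all $w_h,v_h\in V_h$. The semi-discrete solution $u_h:[t_0,t_0+T]\to V_h$ solves $u_{h,t}+L_hu_h=P_hf$, $u_h(t_0)=P_hu_0$. **Time grids.** $[t_0,t_0+T]$ is divided into $N$ coarse intervals $[T_n,T_{n+1}]$ of equal length $\Delta T=T/N$,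 and each coarse interval into $M$ fine intervals of equal length $\Delta t=T/(NM)$; the fine grid points are $t_l=t_0+l\Delta t$, so $T_n=t_{nM}$. **Propagators.** $\mathcal{H}(v;T_n,T_{n+1})\in V_h$ is the value at $T_{n+1}$ of the exact solution of $y_t+L_hy=P_hf$, $y(T_n)=v$. $\mathcal{G}(v;T_n,T_{n+1})\in V_h$ is the result of a (one-step) coarse propagator over $[T_n,T_{n+1}]$ with starting value $v\in V_h$. $\mathcal{F}(v;t_l,t_{l+1})\in V_h$ is the result of a fine propagator over one fine interval, and $\mathcal{F}^M(v;T_n,T_{n+1})$ is obtained by applying successively the $M$ fine steps of $\mathcal{F}$ in $[T_n,T_{n+1}]$ starting from $v$. **Parareal algorithm.** $U_h^{0,(k)}=P_hu_0$ for all $k\ge0$; $U_h^{n+1,(0)}=\mathcal{G}(U_h^{n,(0)};T_n,T_{n+1})$ for $n=0,\dots,N-1$; and for $k\ge0$, $n=0,\dots,N-1$, $$U_h^{n+1,(k+1)}=\mathcal{G}(U_h^{n,(k+1)};T_n,T_{n+1})+\mathcal{F}^M(U_h^{n,(k)};T_n,T_{n+1})-\mathcal{G}(U_h^{n,(k)};T_n,T_{n+1}).$$ *)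

theory Defs
  imports "HOL-Analysis.Analysis" "HOL-Library.Function_Algebras"
begin

text \<open>
  Functions on the domain are plain functions on \<^typ>\<open>real^'d\<close>; everything below only looks at
  their values on \<open>\<Omega>\<close>. Sums and differences of functions are pointwise (\<open>Function_Algebras\<close>).
\<close>

definition L2 :: "(real^'d) set \<Rightarrow> ((real^'d) \<Rightarrow> real) set" where
  "L2 \<Omega> = {u. set_borel_measurable lebesgue \<Omega> u \<and> set_integrable lebesgue \<Omega> (\<lambda>x. (u x)\<^sup>2)}"

definition L2_inner :: "(real^'d) set \<Rightarrow> ((real^'d) \<Rightarrow> real) \<Rightarrow> ((real^'d) \<Rightarrow> real) \<Rightarrow> real" where
  "L2_inner \<Omega> u v = (LINT x:\<Omega>|lebesgue. u x * v x)"

definition L2_norm :: "(real^'d) set \<Rightarrow> ((real^'d) \<Rightarrow> real) \<Rightarrow> real" where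
  "L2_norm \<Omega> u = sqrt (L2_inner \<Omega> u u)"

definition partial :: "'d \<Rightarrow> ((real^'d) \<Rightarrow> real) \<Rightarrow> (real^'d) \<Rightarrow> real" where
  "partial i u x = frechet_derivative u (at x) (axis i 1)"

text \<open>
  For finite element functions this is the classical gradient off the grid hyperplanes, a null
  set, and so represents the weak gradient; on the hyperplanes its value is unspecified.
\<close>
definition grad :: "((real^'d) \<Rightarrow> real) \<Rightarrow> (real^'d) \<Rightarrow> real^'d" where
  "grad u x = (\<chi> i. partial i u x)"


subsection \<open>Sobolev spaces\<close>

primrec Ck :: "nat \<Rightarrow> ((real^'d) \<Rightarrow> real) \<Rightarrow> bool" where
  "Ck 0 u \<longleftrightarrow> continuous_on UNIV u"
| "Ck (Suc k) u \<longleftrightarrow> (\<forall>x. u differentiable (at x)) \<and> (\<forall>i. Ck k (partial i u))"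

definition test_functions :: "(real^'d) set \<Rightarrow> ((real^'d) \<Rightarrow> real) set" where
  "test_functions \<Omega> =
     {\<phi>. (\<forall>k. Ck k \<phi>) \<and> compact (closure {x. \<phi> x \<noteq> 0}) \<and> closure {x. \<phi> x \<noteq> 0} \<subseteq> \<Omega>}"

definition weak_partial ::
  "(real^'d) set \<Rightarrow> 'd \<Rightarrow> ((real^'d) \<Rightarrow> real) \<Rightarrow> ((real^'d) \<Rightarrow> real) \<Rightarrow> bool" where
  "weak_partial \<Omega> i u g \<longleftrightarrow>
     (\<forall>\<phi>\<in>test_functions \<Omega>. L2_inner \<Omega> u (partial i \<phi>) = - L2_inner \<Omega> g \<phi>)"

definition H2 :: "(real^'d) set \<Rightarrow> ((real^'d) \<Rightarrow> real) set" where
  "H2 \<Omega> = {u \<in> L2 \<Omega>. \<forall>i. \<exists>g\<in>L2 \<Omega>. weak_partial \<Omega> i u g \<and>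
                              (\<forall>j. \<exists>r\<in>L2 \<Omega>. weak_partial \<Omega> j g r)}"

text \<open>The closure of the test functions in the \<open>H\<^sup>1\<close>-norm.\<close>
definition H10 :: "(real^'d) set \<Rightarrow> ((real^'d) \<Rightarrow> real) set" where
  "H10 \<Omega> = {u \<in> L2 \<Omega>. \<exists>g \<phi>.
     (\<forall>i. g i \<in> L2 \<Omega> \<and> weak_partial \<Omega> i u (g i)) \<and>
     (\<forall>n::nat. \<phi> n \<in> test_functions \<Omega>) \<and>
     (\<lambda>n. L2_norm \<Omega> (\<phi> n - u)) \<longlonglongrightarrow> 0 \<and>
     (\<forall>i. (\<lambda>n. L2_norm \<Omega> (partial i (\<phi> n) - g i)) \<longlonglongrightarrow> 0)}"


subsection \<open>Space discretization\<close>

text \<open>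
  The domain is \<open>box a b\<close>, and \<open>m i\<close> is the number of cells in direction \<open>i\<close>. The nodes in
  direction \<open>i\<close> are \<open>a\<^sub>i + j h\<^sub>i\<close> for \<open>0 \<le> j \<le> m i\<close>; those with \<open>0 < j < m i\<close> are the interior
  ones, whose nodal functions vanish at both endpoints.
\<close>

definition mesh_size :: "real^'d \<Rightarrow> real^'d \<Rightarrow> ('d \<Rightarrow> nat) \<Rightarrow> 'd \<Rightarrow> real" where
  "mesh_size a b m i = (b $ i - a $ i) / real (m i)"

definition max_mesh_size :: "real^'d \<Rightarrow> real^'d \<Rightarrow> ('d \<Rightarrow> nat) \<Rightarrow> real" where
  "max_mesh_size a b m = (MAX i. mesh_size a b m i)"

definition hat :: "real^'d \<Rightarrow> real^'d \<Rightarrow> ('d \<Rightarrow> nat) \<Rightarrow> 'd \<Rightarrow> nat \<Rightarrow> real \<Rightarrow> real" where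
  "hat a b m i j s =
     max 0 (1 - \<bar>s - (a $ i + real j * mesh_size a b m i)\<bar> / mesh_size a b m i)"

text \<open>The span of the tensor products of hats. All its elements vanish outside \<open>box a b\<close>.\<close>
definition Vh :: "real^'d \<Rightarrow> real^'d \<Rightarrow> ('d \<Rightarrow> nat) \<Rightarrow> ((real^'d) \<Rightarrow> real) set" where
  "Vh a b m = {v. \<exists>c. v = (\<lambda>x. \<Sum>j | \<forall>i. 0 < j i \<and> j i < m i.
                              c j * (\<Prod>i\<in>UNIV. hat a b m i (j i) (x $ i)))}"

definition Ph ::
  "real^'d \<Rightarrow> real^'d \<Rightarrow> ('d \<Rightarrow> nat) \<Rightarrow> ((real^'d) \<Rightarrow> real) \<Rightarrow> (real^'d) \<Rightarrow> real" where
  "Ph a b m g = (THE w. w \<in> Vh a b m \<and>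
     (\<forall>v\<in>Vh a b m. L2_inner (box a b) w v = L2_inner (box a b) g v))"

definition Lh ::
  "real \<Rightarrow> real^'d \<Rightarrow> real^'d \<Rightarrow> ('d \<Rightarrow> nat) \<Rightarrow> ((real^'d) \<Rightarrow> real) \<Rightarrow> (real^'d) \<Rightarrow> real" where
  "Lh D a b m w = (THE z. z \<in> Vh a b m \<and>
     (\<forall>v\<in>Vh a b m. L2_inner (box a b) z v =
                    (LINT x:box a b|lebesgue. D * (grad w x \<bullet> grad v x))))"

text \<open>
  Strong derivative in \<open>L\<^sup>2(\<Omega>)\<close>; on the finite-dimensional space \<^const>\<open>Vh\<close> this is the
  derivative with respect to any norm. It is one-sided at the endpoints of the time interval \<open>I\<close>.
\<close>
definition has_L2_derivative ::
  "(real^'d) set \<Rightarrow> (real \<Rightarrow> (real^'d) \<Rightarrow> real) \<Rightarrow> ((real^'d) \<Rightarrow> real) \<Rightarrow> real \<Rightarrow> real set \<Rightarrow> bool" where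
  "has_L2_derivative \<Omega> y y' t I \<longleftrightarrow>
     ((\<lambda>r. L2_norm \<Omega> (\<lambda>x. (y r x - y t x) / (r - t) - y' x)) \<longlongrightarrow> 0) (at t within I)"

text \<open>\<open>y\<close> solves \<open>y\<^sub>t + L\<^sub>h y = P\<^sub>h f\<close> on \<open>[s, e]\<close> with values in \<open>V\<^sub>h\<close>.\<close>
definition semidiscrete_solution ::
  "real \<Rightarrow> real^'d \<Rightarrow> real^'d \<Rightarrow> ('d \<Rightarrow> nat) \<Rightarrow> (real \<Rightarrow> (real^'d) \<Rightarrow> real) \<Rightarrow>
   real \<Rightarrow> real \<Rightarrow> (real \<Rightarrow> (real^'d) \<Rightarrow> real) \<Rightarrow> bool" where
  "semidiscrete_solution D a b m f s e y \<longleftrightarrow>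
     (\<forall>t\<in>{s..e}. y t \<in> Vh a b m \<and>
       (\<exists>y'\<in>Vh a b m. has_L2_derivative (box a b) y y' t {s..e} \<and>
                       y' + Lh D a b m (y t) = Ph a b m (f t)))"

definition exact_propagator ::
  "real \<Rightarrow> real^'d \<Rightarrow> real^'d \<Rightarrow> ('d \<Rightarrow> nat) \<Rightarrow> (real \<Rightarrow> (real^'d) \<Rightarrow> real) \<Rightarrow>
   ((real^'d) \<Rightarrow> real) \<Rightarrow> real \<Rightarrow> real \<Rightarrow> (real^'d) \<Rightarrow> real" where
  "exact_propagator D a b m f v s e =
     (THE w. \<exists>y. semidiscrete_solution D a b m f s e y \<and> y s = v \<and> y e = w)"


subsection \<open>Time grids and the Parareal algorithm\<close>

datatype 'd discretization =
  Discretization (cells: "'d \<Rightarrow> nat") (num_coarse: nat) (num_fine: nat)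

definition valid_discretization :: "'d discretization \<Rightarrow> bool" where
  "valid_discretization \<delta> \<longleftrightarrow> (\<forall>i. cells \<delta> i \<ge> 1) \<and> num_coarse \<delta> \<ge> 1 \<and> num_fine \<delta> \<ge> 1"

definition coarse_step :: "real \<Rightarrow> 'd discretization \<Rightarrow> real" where
  "coarse_step T \<delta> = T / real (num_coarse \<delta>)"

definition fine_step :: "real \<Rightarrow> 'd discretization \<Rightarrow> real" where
  "fine_step T \<delta> = T / real (num_coarse \<delta> * num_fine \<delta>)"

definition fine_time :: "real \<Rightarrow> real \<Rightarrow> 'd discretization \<Rightarrow> nat \<Rightarrow> real" where
  "fine_time t0 T \<delta> l = t0 + real l * fine_step T \<delta>"

definition coarse_time :: "real \<Rightarrow> real \<Rightarrow> 'd discretization \<Rightarrow> nat \<Rightarrow> real" where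
  "coarse_time t0 T \<delta> n = fine_time t0 T \<delta> (n * num_fine \<delta>)"

text \<open>
  A one-step propagator maps a starting value \<open>v\<close> and a time interval given by its endpoints
  to a value at the right endpoint.
\<close>
type_synonym 'd propagator = "((real^'d) \<Rightarrow> real) \<Rightarrow> real \<Rightarrow> real \<Rightarrow> (real^'d) \<Rightarrow> real"

text \<open>\<open>j\<close> successive fine steps, starting at the fine grid point with index \<open>l\<close>.\<close>
primrec fine_iterate ::
  "real \<Rightarrow> real \<Rightarrow> 'd::finite discretization \<Rightarrow> 'd propagator \<Rightarrow> nat \<Rightarrow> nat \<Rightarrow>
   ((real^'d) \<Rightarrow> real) \<Rightarrow> (real^'d) \<Rightarrow> real" where
  "fine_iterate t0 T \<delta> F l 0 v = v"
| "fine_iterate t0 T \<delta> F l (Suc j) v =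
     F (fine_iterate t0 T \<delta> F l j v) (fine_time t0 T \<delta> (l + j)) (fine_time t0 T \<delta> (l + Suc j))"

definition fine_propagator ::
  "real \<Rightarrow> real \<Rightarrow> 'd::finite discretization \<Rightarrow> 'd propagator \<Rightarrow> nat \<Rightarrow>
   ((real^'d) \<Rightarrow> real) \<Rightarrow> (real^'d) \<Rightarrow> real" where
  "fine_propagator t0 T \<delta> F n = fine_iterate t0 T \<delta> F (n * num_fine \<delta>) (num_fine \<delta>)"

text \<open>
  \<open>parareal g fM v n k\<close> is \<open>U\<^sub>h\<close> at coarse time index \<open>n\<close> and iteration \<open>k\<close>; \<open>g n\<close> and \<open>fM n\<close> are the
  coarse propagator and the iterated fine propagator over the \<open>n\<close>-th coarse interval.
\<close>
fun parareal ::
  "(nat \<Rightarrow> ((real^'d) \<Rightarrow> real) \<Rightarrow> (real^'d) \<Rightarrow> real) \<Rightarrow>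
   (nat \<Rightarrow> ((real^'d) \<Rightarrow> real) \<Rightarrow> (real^'d) \<Rightarrow> real) \<Rightarrow>
   ((real^'d) \<Rightarrow> real) \<Rightarrow> nat \<Rightarrow> nat \<Rightarrow> (real^'d) \<Rightarrow> real" where
  "parareal g fM v 0 k = v"
| "parareal g fM v (Suc n) 0 = g n (parareal g fM v n 0)"
| "parareal g fM v (Suc n) (Suc k) =
     g n (parareal g fM v n (Suc k)) + fM n (parareal g fM v n k) - g n (parareal g fM v n k)"

definition over_coarse ::
  "real \<Rightarrow> real \<Rightarrow> 'd::finite discretization \<Rightarrow> 'd propagator \<Rightarrow> nat \<Rightarrow>
   ((real^'d) \<Rightarrow> real) \<Rightarrow> (real^'d) \<Rightarrow> real" where
  "over_coarse t0 T \<delta> G n v = G v (coarse_time t0 T \<delta> n) (coarse_time t0 T \<delta> (Suc n))"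

end

theory Submission
  imports Defs
begin

text \<open>
  Once \<open>k \<ge> n\<close>, the two coarse terms of the Parareal correction cancel, so from iteration \<open>N\<close> on the
  algorithm reproduces the sequential fine solution. Its error satisfies
  \<open>e\<^sub>n\<^sub>+\<^sub>1 \<le> (1 + K \<Delta>T) e\<^sub>n + C (\<Delta>t)\<^bsup>q+1\<^esup>\<close>, where the stability of the exact propagator is the case
  \<open>v = w\<close> of the second half of condition 3; a discrete Gronwall argument and \<open>N \<Delta>t \<le> T\<close> conclude.

  The exact propagator is a definite description, so this needs the semi-discrete problem to be
  uniquely solvable from every starting value in \<open>V\<^sub>h\<close> (otherwise its values might fail to be square
  integrable and the triangle inequality would break down). In nodal coordinates the problem reads
  \<open>M c' = - D A c + \<dots>\<close> with mass matrix \<open>M\<close> and stiffness matrix \<open>A\<close>. Uniqueness follows from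
  the decay of the energy \<open>c \<cdot> M c\<close>. As nothing is assumed about the time regularity of \<open>f\<close>,
  existence is obtained by adding a solution of the homogeneous problem to the given \<open>u\<^sub>h\<close>.
\<close>

subsection \<open>Linear systems and linear differential equations\<close>

text \<open>Gram-Schmidt: the vector \<open>r\<close> below is the new basis vector made \<open>M\<close>-orthogonal to the old ones.\<close>
lemma linear_system_solvable:
  fixes M :: "'j \<Rightarrow> 'j \<Rightarrow> real"
  assumes "finite J"
    and "\<And>c. (\<Sum>j\<in>J. \<Sum>k\<in>J. c j * c k * M j k) \<le> 0 \<Longrightarrow> \<forall>j\<in>J. c j = 0"
  shows "\<exists>z. \<forall>k\<in>J. (\<Sum>j\<in>J. z j * M j k) = l k"
  using assms
proof (induction J arbitrary: l rule: finite_induct)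
  case empty
  then show ?case by simp
next
  case (insert x J)
  have pd: "\<forall>j\<in>J. c j = 0" if "(\<Sum>j\<in>J. \<Sum>k\<in>J. c j * c k * M j k) \<le> 0" for c
  proof -
    \<comment> \<open>Extending \<open>c\<close> by zero at \<open>x\<close> lets the smaller system
      inherit definiteness from the larger one.\<close>
    define d where "d j = (if j \<in> J then c j else 0)" for j
    have "(\<Sum>j\<in>insert x J. \<Sum>k\<in>insert x J. d j * d k * M j k) = (\<Sum>j\<in>J. \<Sum>k\<in>J. c j * c k * M j k)"
      using insert.hyps by (simp add: d_def)
    with that insert.prems[of d] show ?thesis by (auto simp: d_def)
  qed
  \<comment> \<open>The right-hand side is row \<open>x\<close> of \<open>M\<close>, which gives the
    coefficients of the orthogonal projection subtracted in \<open>r\<close>.\<close>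
  obtain y where y: "\<And>k. k \<in> J \<Longrightarrow> (\<Sum>j\<in>J. y j * M j k) = M x k"
    using insert.IH[OF pd, of "M x"] by blast
  obtain z where z: "\<And>k. k \<in> J \<Longrightarrow> (\<Sum>j\<in>J. z j * M j k) = l k"
    using insert.IH[OF pd, of l] by blast
  define r where "r j = (if j = x then 1 else - y j)" for j
  have r_sum: "(\<Sum>j\<in>J. r j * M j k) = - (\<Sum>j\<in>J. y j * M j k)" for k
    unfolding sum_negf[symmetric] using insert.hyps by (intro sum.cong) (auto simp: r_def)
  have r0: "(\<Sum>j\<in>insert x J. r j * M j k) = 0" if "k \<in> J" for k
    using insert.hyps that y r_sum[of k] by (simp add: r_def)
  define \<rho> where "\<rho> = (\<Sum>j\<in>insert x J. r j * M j x)"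
  have "(\<Sum>j\<in>insert x J. \<Sum>k\<in>insert x J. r j * r k * M j k)
      = (\<Sum>k\<in>insert x J. r k * (\<Sum>j\<in>insert x J. r j * M j k))"
    by (subst sum.swap) (simp add: sum_distrib_left mult_ac)
  also have "\<dots> = r x * \<rho> + (\<Sum>k\<in>J. r k * (\<Sum>j\<in>insert x J. r j * M j k))"
    unfolding \<rho>_def using insert.hyps by (subst sum.insert) auto
  also have "\<dots> = \<rho>"
    using r0 by (simp add: r_def)
  \<comment> \<open>Were \<open>\<rho>\<close> not positive, definiteness would force
    \<open>r x = 0\<close>, whereas \<open>r x = 1\<close>.\<close>
  finally have "\<rho> > 0"
    using insert.prems[of r] by (force simp: r_def)
  \<comment> \<open>Adding a multiple of \<open>r\<close> preserves the equations with index in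
    \<open>J\<close> by \<open>r0\<close>; \<open>\<beta>\<close> is the multiple that repairs the
    equation at \<open>x\<close>.\<close>
  define \<beta> where "\<beta> = (l x - (\<Sum>j\<in>J. z j * M j x)) / \<rho>"
  define z' where "z' j = (if j \<in> J then z j else 0)" for j
  define w where "w j = z' j + \<beta> * r j" for j
  have w: "(\<Sum>j\<in>insert x J. w j * M j k)
      = (\<Sum>j\<in>J. z j * M j k) + \<beta> * (\<Sum>j\<in>insert x J. r j * M j k)" for k
  proof -
    have "(\<Sum>j\<in>insert x J. w j * M j k)
      = (\<Sum>j\<in>insert x J. z' j * M j k) + \<beta> * (\<Sum>j\<in>insert x J. r j * M j k)"
      unfolding w_def sum_distrib_left sum.distrib[symmetric] by (intro sum.cong refl) algebra
    also have "(\<Sum>j\<in>insert x J. z' j * M j k) = (\<Sum>j\<in>J. z j * M j k)"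
      using insert.hyps by (simp add: z'_def)
    finally show ?thesis .
  qed
  have "(\<Sum>j\<in>insert x J. w j * M j k) = l k" if "k \<in> insert x J" for k
  proof (cases "k = x")
    case True
    then show ?thesis using w[of x] \<open>\<rho> > 0\<close> by (simp add: \<rho>_def[symmetric] \<beta>_def del: sum.insert)
  next
    case False
    then show ?thesis using that w[of k] r0[of k] z[of k] by (simp del: sum.insert)
  qed
  then show ?case by blast
qed

text \<open>The solution is the matrix exponential applied to \<open>c0\<close>, written
  coordinatewise: \<open>P n\<close> is the \<open>n\<close>-th iterate of \<open>B\<close> on
  \<open>c0\<close>, and coordinate \<open>j\<close> is the power series in \<open>t\<close> with
  coefficients \<open>P n j / fact n\<close>. Termwise differentiation replaces \<open>P n\<close>
  by \<open>P (Suc n)\<close>, which is one more application of \<open>B\<close>.\<close>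

lemma linear_ode_solution_exists:
  fixes B :: "'j \<Rightarrow> 'j \<Rightarrow> real"
  assumes "finite J"
  shows "\<exists>c. (\<forall>j\<in>J. c 0 j = c0 j) \<and>
    (\<forall>t. \<forall>j\<in>J. ((\<lambda>t. c t j) has_real_derivative (\<Sum>k\<in>J. B j k * c t k)) (at t))"
proof -
  define P where "P n = ((\<lambda>v j. \<Sum>k\<in>J. B j k * v k) ^^ n) c0" for n
  have P_Suc: "P (Suc n) j = (\<Sum>k\<in>J. B j k * P n k)" for n j
    by (simp add: P_def)
  \<comment> \<open>\<open>K\<close> dominates every absolute row sum of \<open>B\<close>, so each
    application of \<open>B\<close> enlarges the common bound on the entries by at most a factor
    \<open>K\<close>; the series is thus majorized by that of
    \<open>L * exp (K * \<bar>t\<bar>)\<close>.\<close>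
  define K where "K = (\<Sum>j\<in>J. \<Sum>k\<in>J. \<bar>B j k\<bar>)"
  define L where "L = (\<Sum>j\<in>J. \<bar>c0 j\<bar>)"
  have "K \<ge> 0" "L \<ge> 0" by (simp_all add: K_def L_def sum_nonneg)
  have bound: "\<bar>P n j\<bar> \<le> K ^ n * L" if "j \<in> J" for n j
    using that
  proof (induction n arbitrary: j)
    case 0
    then show ?case using assms by (auto simp: P_def L_def intro: member_le_sum)
  next
    case (Suc n)
    have "\<bar>P (Suc n) j\<bar> \<le> (\<Sum>k\<in>J. \<bar>B j k\<bar> * (K ^ n * L))"
      unfolding P_Suc by (rule order_trans[OF sum_abs]) (auto simp: abs_mult intro!: sum_mono mult_left_mono Suc)
    also have "\<dots> = (\<Sum>k\<in>J. \<bar>B j k\<bar>) * (K ^ n * L)"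
      by (simp add: sum_distrib_right)
    also have "\<dots> \<le> K * (K ^ n * L)"
    proof (rule mult_right_mono)
      show "(\<Sum>k\<in>J. \<bar>B j k\<bar>) \<le> K"
        unfolding K_def using assms Suc.prems by (intro member_le_sum) (auto intro: sum_nonneg)
    qed (use \<open>K \<ge> 0\<close> \<open>L \<ge> 0\<close> in auto)
    finally show ?case by simp
  qed
  have summ: "summable (\<lambda>n. P n j / fact n * t ^ n)" if "j \<in> J" for j t
  proof (rule summable_comparison_test')
    show "summable (\<lambda>n. L * (inverse (fact n) * (K * \<bar>t\<bar>) ^ n))"
      by (intro summable_mult summable_exp)
    show "norm (P n j / fact n * t ^ n) \<le> L * (inverse (fact n) * (K * \<bar>t\<bar>) ^ n)" if "n \<ge> 0" for n
    proof -
      have "norm (P n j / fact n * t ^ n) = \<bar>P n j\<bar> * (inverse (fact n) * \<bar>t\<bar> ^ n)"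
        by (simp add: abs_mult power_abs divide_inverse)
      also have "\<dots> \<le> (K ^ n * L) * (inverse (fact n) * \<bar>t\<bar> ^ n)"
        by (intro mult_right_mono bound \<open>j \<in> J\<close>) auto
      finally show ?thesis by (simp add: power_mult_distrib mult_ac)
    qed
  qed
  define c where "c t j = (\<Sum>n. P n j / fact n * t ^ n)" for t j
  have "c 0 j = c0 j" for j
    using powser_zero[of "\<lambda>n. P n j / fact n"] by (simp add: c_def P_def)
  moreover have "((\<lambda>t. c t j) has_real_derivative (\<Sum>k\<in>J. B j k * c t k)) (at t)" if "j \<in> J" for t j
  proof -
    have "diffs (\<lambda>n. P n j / fact n) n = P (Suc n) j / fact n" for n
      by (simp add: diffs_def del: of_nat_Suc)
    then have "diffs (\<lambda>n. P n j / fact n) n = (\<Sum>k\<in>J. B j k * (P n k / fact n))" for n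
      by (simp add: P_Suc sum_divide_distrib)
    then have "(\<Sum>n. diffs (\<lambda>n. P n j / fact n) n * t ^ n)
        = (\<Sum>n. \<Sum>k\<in>J. B j k * (P n k / fact n * t ^ n))"
      by (simp add: sum_distrib_left mult_ac)
    also have "\<dots> = (\<Sum>k\<in>J. \<Sum>n. B j k * (P n k / fact n * t ^ n))"
      by (intro suminf_sum summable_mult summ)
    also have "\<dots> = (\<Sum>k\<in>J. B j k * c t k)"
      unfolding c_def by (intro sum.cong refl suminf_mult summ)
    finally show ?thesis
      using termdiffs_strong_converges_everywhere[OF summ[OF that], of t] by (simp add: c_def)
  qed
  ultimately show ?thesis by blast
qed

subsection \<open>The finite element space in nodal coordinates\<close>

lemma AE_component_neq: "AE x::real^'d in lebesgue. x $ i \<noteq> c"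
proof (rule AE_I')
  show "{x::real^'d. x $ i = c} \<in> null_sets lebesgue"
    using negligible_standard_hyperplane[of "axis i 1 :: real^'d" c]
    by (simp add: negligible_iff_null_sets axis_in_Basis_iff inner_axis)
qed auto

text \<open>The slope of the hat away from its kinks, and 0 at the kinks. An explicit formula avoids
  the unspecified values of the derivative there and makes measurability direct.\<close>

definition hat_deriv :: "real^'d \<Rightarrow> real^'d \<Rightarrow> ('d \<Rightarrow> nat) \<Rightarrow> 'd \<Rightarrow> nat \<Rightarrow> real \<Rightarrow> real" where
  "hat_deriv a b m i j s =
     (let h = mesh_size a b m i; c = a $ i + real j * h
      in if \<bar>s - c\<bar> < h then - sgn (s - c) / h else 0)"

locale finite_element_space =
  fixes a b :: "real^'d" and m :: "'d \<Rightarrow> nat"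
  assumes a_less_b: "a $ i < b $ i" and m_pos: "1 \<le> m i"
begin

text \<open>Multi-indices of the interior nodes. If some direction has a single cell, the set is
  empty and \<open>Vh\<close> contains only the zero function.\<close>

definition J :: "('d \<Rightarrow> nat) set" where
  "J = {j. \<forall>i. 0 < j i \<and> j i < m i}"

definition node :: "('d \<Rightarrow> nat) \<Rightarrow> real^'d" where
  "node j = (\<chi> i. a $ i + real (j i) * mesh_size a b m i)"

definition basis_fun :: "('d \<Rightarrow> nat) \<Rightarrow> real^'d \<Rightarrow> real" where
  "basis_fun j x = (\<Prod>i\<in>UNIV. hat a b m i (j i) (x $ i))"

text \<open>The product rule as a formula defined everywhere; it stands in for the classical
  gradient, with which it agrees off the grid hyperplanes.\<close>

definition basis_grad :: "('d \<Rightarrow> nat) \<Rightarrow> real^'d \<Rightarrow> real^'d" where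
  "basis_grad j x =
     (\<chi> i. hat_deriv a b m i (j i) (x $ i) * (\<Prod>k\<in>UNIV - {i}. hat a b m k (j k) (x $ k)))"

definition comb :: "(('d \<Rightarrow> nat) \<Rightarrow> real) \<Rightarrow> real^'d \<Rightarrow> real" where
  "comb c x = (\<Sum>j\<in>J. c j * basis_fun j x)"

text \<open>Nodal evaluation makes sense for every function, so it is additive without any
  membership condition; on \<open>Vh\<close> it yields the coordinates in the nodal basis.\<close>

definition coef :: "(real^'d \<Rightarrow> real) \<Rightarrow> ('d \<Rightarrow> nat) \<Rightarrow> real" where
  "coef v j = v (node j)"

definition mass :: "('d \<Rightarrow> nat) \<Rightarrow> ('d \<Rightarrow> nat) \<Rightarrow> real" where
  "mass j k = L2_inner (box a b) (basis_fun j) (basis_fun k)"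

definition stiffness :: "('d \<Rightarrow> nat) \<Rightarrow> ('d \<Rightarrow> nat) \<Rightarrow> real" where
  "stiffness j k = (LINT x:box a b|lebesgue. basis_grad j x \<bullet> basis_grad k x)"

section \<open>Nodes and nodal coordinates\<close>

lemma finite_J: "finite J"
proof (rule finite_subset)
  show "J \<subseteq> PiE UNIV (\<lambda>i. {..<m i})" by (auto simp: J_def)
qed (simp add: finite_PiE)

lemma mesh_size_pos: "0 < mesh_size a b m i"
  using a_less_b[of i] m_pos[of i] by (simp add: mesh_size_def)

lemma node_in_box:
  assumes "j \<in> J" shows "node j \<in> box a b"
proof -
  have "a $ i < node j $ i" "node j $ i < b $ i" for i
  proof -
    have j: "0 < j i" "j i < m i" using assms by (auto simp: J_def)
    show "a $ i < node j $ i" using j mesh_size_pos[of i] by (simp add: node_def)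
    have "real (j i) * mesh_size a b m i < real (m i) * mesh_size a b m i"
      using j mesh_size_pos[of i] by simp
    also have "\<dots> = b $ i - a $ i" using m_pos[of i] by (simp add: mesh_size_def)
    finally show "node j $ i < b $ i" by (simp add: node_def)
  qed
  then show ?thesis by (simp add: mem_box_cart)
qed

lemma hat_node: "hat a b m i j (a $ i + real j' * mesh_size a b m i) = of_bool (j' = j)"
proof -
  let ?h = "mesh_size a b m i"
  have "hat a b m i j (a $ i + real j' * ?h) = max 0 (1 - \<bar>(real j' - real j) * ?h\<bar> / ?h)"
    by (simp add: hat_def algebra_simps)
  also have "\<dots> = max 0 (1 - \<bar>real j' - real j\<bar>)"
    using mesh_size_pos[of i] by (simp add: abs_mult)
  also have "\<dots> = of_bool (j' = j)"
    by (cases j' j rule: linorder_cases) auto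
  finally show ?thesis .
qed

text \<open>A direction in which the multi-indices differ contributes a zero factor.\<close>

lemma basis_fun_node: "basis_fun j (node j') = of_bool (j' = j)"
proof (cases "j' = j")
  case True
  then show ?thesis by (simp add: basis_fun_def node_def hat_node)
next
  case False
  then obtain i where "j' i \<noteq> j i" by blast
  then show ?thesis
    using False by (auto simp: basis_fun_def node_def hat_node intro!: prod_zero)
qed

lemma Vh_eq: "Vh a b m = range comb"
  by (auto simp: Vh_def comb_def[abs_def] J_def basis_fun_def)

lemma comb_in_Vh: "comb c \<in> Vh a b m"
  by (simp add: Vh_eq)

lemma coef_comb: "j \<in> J \<Longrightarrow> coef (comb c) j = c j"
  using finite_J by (simp add: coef_def comb_def basis_fun_node)

lemma comb_cong: "(\<And>j. j \<in> J \<Longrightarrow> c j = d j) \<Longrightarrow> comb c = comb d"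
  by (simp add: comb_def[abs_def])

lemma comb_coef: "v \<in> Vh a b m \<Longrightarrow> comb (coef v) = v"
  by (auto simp: Vh_eq coef_comb intro: comb_cong)

lemma coef_add: "coef (u + v) j = coef u j + coef v j"
  by (simp add: coef_def)

lemma comb_add: "comb c + comb d = comb (\<lambda>j. c j + d j)"
  and comb_diff: "comb c - comb d = comb (\<lambda>j. c j - d j)"
  by (auto simp: comb_def distrib_right left_diff_distrib sum.distrib sum_subtractf)

lemma Vh_add: "u \<in> Vh a b m \<Longrightarrow> v \<in> Vh a b m \<Longrightarrow> u + v \<in> Vh a b m"
  and Vh_diff: "u \<in> Vh a b m \<Longrightarrow> v \<in> Vh a b m \<Longrightarrow> u - v \<in> Vh a b m"
  by (auto simp: Vh_eq comb_add comb_diff)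

section \<open>Regularity and gradients of the basis functions\<close>

lemma hat_nonneg: "0 \<le> hat a b m i j s"
  and hat_le_1: "hat a b m i j s \<le> 1"
  using mesh_size_pos[of i] by (auto simp: hat_def)

lemma continuous_on_hat [continuous_intros]:
  "continuous_on S g \<Longrightarrow> continuous_on S (\<lambda>x. hat a b m i j (g x))"
  unfolding hat_def using mesh_size_pos[of i] by (auto intro!: continuous_intros)

lemma continuous_on_basis_fun: "continuous_on S (basis_fun j)"
  unfolding basis_fun_def[abs_def] by (intro continuous_intros)

lemma continuous_on_comb: "continuous_on S (comb c)"
  unfolding comb_def[abs_def] by (intro continuous_intros continuous_on_basis_fun)

text \<open>Between its kinks the hat agrees on an open interval with an affine function, and beyond
  them with zero.\<close>

lemma hat_has_derivative:
  fixes i j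
  defines "h \<equiv> mesh_size a b m i"
  defines "c \<equiv> a $ i + real j * h"
  assumes "s \<noteq> c - h" "s \<noteq> c" "s \<noteq> c + h"
  shows "(hat a b m i j has_real_derivative hat_deriv a b m i j s) (at s)"
proof -
  have h: "h > 0" using mesh_size_pos by (simp add: h_def)
  have hat: "hat a b m i j x = max 0 (1 - \<bar>x - c\<bar> / h)" for x
    by (simp add: hat_def c_def h_def)
  have dhat: "hat_deriv a b m i j x = (if \<bar>x - c\<bar> < h then - sgn (x - c) / h else 0)" for x
    by (simp add: hat_deriv_def c_def h_def Let_def)
  consider "s < c - h" | "s > c + h" | "c - h < s" "s < c" | "c < s" "s < c + h"
    using assms(3-5) by linarith
  then show ?thesis
  proof cases
    case 1
    have "((\<lambda>_. 0) has_real_derivative 0) (at s)" by simp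
    then have "(hat a b m i j has_real_derivative 0) (at s)"
      by (rule has_field_derivative_transform_within_open[where S = "{..<c - h}"])
        (use 1 h in \<open>auto simp: hat max_def field_simps\<close>)
    moreover have "\<not> \<bar>s - c\<bar> < h" using 1 by linarith
    ultimately show ?thesis by (simp add: dhat)
  next
    case 2
    have "((\<lambda>_. 0) has_real_derivative 0) (at s)" by simp
    then have "(hat a b m i j has_real_derivative 0) (at s)"
      by (rule has_field_derivative_transform_within_open[where S = "{c + h<..}"])
        (use 2 h in \<open>auto simp: hat max_def field_simps\<close>)
    moreover have "\<not> \<bar>s - c\<bar> < h" using 2 by linarith
    ultimately show ?thesis by (simp add: dhat)
  next
    case 3
    have "((\<lambda>x. 1 - (c - x) / h) has_real_derivative 1 / h) (at s)"
      using h by (auto intro!: derivative_eq_intros)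
    then have "(hat a b m i j has_real_derivative 1 / h) (at s)"
      by (rule has_field_derivative_transform_within_open[where S = "{c - h<..<c}"])
        (use 3 h in \<open>auto simp: hat max_def field_simps\<close>)
    then show ?thesis using 3 by (simp add: dhat)
  next
    case 4
    have "((\<lambda>x. 1 - (x - c) / h) has_real_derivative - 1 / h) (at s)"
      using h by (auto intro!: derivative_eq_intros)
    then have "(hat a b m i j has_real_derivative - 1 / h) (at s)"
      by (rule has_field_derivative_transform_within_open[where S = "{c<..<c + h}"])
        (use 4 h in \<open>auto simp: hat max_def field_simps\<close>)
    then show ?thesis using 4 by (simp add: dhat)
  qed
qed

text \<open>\<open>\<sigma>\<close> selects the left end, the peak and the right end of the support
  of each hat, the three points where it has a kink.\<close>

definition off_grid :: "real^'d \<Rightarrow> bool" where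
  "off_grid x \<longleftrightarrow> (\<forall>j\<in>J. \<forall>i. \<forall>\<sigma>\<in>{-1, 0, 1}.
     x $ i \<noteq> a $ i + real (j i) * mesh_size a b m i + \<sigma> * mesh_size a b m i)"

text \<open>Only finitely many hyperplanes are excluded, each of measure zero.\<close>

lemma AE_off_grid: "AE x in lebesgue. off_grid x"
  unfolding off_grid_def
  by (intro AE_finite_allI finite_J finite_insert[THEN iffD2] finite.emptyI AE_component_neq
        AE_all_countable[THEN iffD2] allI)

lemma basis_fun_has_derivative:
  assumes "off_grid x" "j \<in> J"
  shows "(basis_fun j has_derivative (\<lambda>y. basis_grad j x \<bullet> y)) (at x)"
proof -
  have "(basis_fun j has_derivative
     (\<lambda>y. \<Sum>i\<in>UNIV. (hat_deriv a b m i (j i) (x $ i) * y $ i) * (\<Prod>k\<in>UNIV - {i}. hat a b m k (j k) (x $ k)))) (at x)"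
    unfolding basis_fun_def[abs_def]
  proof (rule has_derivative_prod)
    fix i
    let ?h = "mesh_size a b m i"
    have "x $ i \<noteq> a $ i + real (j i) * ?h - ?h" "x $ i \<noteq> a $ i + real (j i) * ?h"
      "x $ i \<noteq> a $ i + real (j i) * ?h + ?h"
      using assms unfolding off_grid_def by (auto dest!: bspec spec[of _ i])
    then have "(hat a b m i (j i) has_derivative (*) (hat_deriv a b m i (j i) (x $ i))) (at (x $ i))"
      using hat_has_derivative by (simp add: has_field_derivative_def)
    moreover have "((\<lambda>x. x $ i) has_derivative (\<lambda>y. y $ i)) (at x)"
      by (rule bounded_linear_imp_has_derivative[OF bounded_linear_vec_nth])
    ultimately show "((\<lambda>x. hat a b m i (j i) (x $ i)) has_derivative
        (\<lambda>y. hat_deriv a b m i (j i) (x $ i) * y $ i)) (at x)"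
      using has_derivative_compose by blast
  qed
  then show ?thesis by (simp add: basis_grad_def inner_vec_def mult_ac)
qed

lemma grad_comb:
  assumes "off_grid x"
  shows "grad (comb c) x = (\<Sum>j\<in>J. c j *\<^sub>R basis_grad j x)"
proof -
  have "(comb c has_derivative (\<lambda>y. \<Sum>j\<in>J. c j * (basis_grad j x \<bullet> y))) (at x)"
    unfolding comb_def[abs_def]
    by (intro has_derivative_sum has_derivative_mult_right basis_fun_has_derivative assms)
  then have "frechet_derivative (comb c) (at x) = (\<lambda>y. (\<Sum>j\<in>J. c j *\<^sub>R basis_grad j x) \<bullet> y)"
    by (simp add: frechet_derivative_at[symmetric] inner_sum_left)
  then show ?thesis by (simp add: grad_def partial_def vec_eq_iff inner_axis)
qed

text \<open>The slopes are at most \<open>1 / mesh_size a b m i\<close> and the remaining factors at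
  most 1. On the bounded box this makes products of gradients integrable.\<close>

lemma norm_basis_grad_bound: "\<exists>K. \<forall>x. norm (basis_grad j x) \<le> K"
proof (intro exI allI)
  fix x
  have "\<bar>basis_grad j x $ i\<bar> \<le> 1 / mesh_size a b m i" for i
  proof -
    have "\<bar>\<Prod>k\<in>UNIV - {i}. hat a b m k (j k) (x $ k)\<bar> \<le> 1"
      by (auto simp: abs_prod hat_nonneg hat_le_1 intro!: prod_le_1)
    moreover have "\<bar>hat_deriv a b m i (j i) (x $ i)\<bar> \<le> 1 / mesh_size a b m i"
      using mesh_size_pos[of i] by (auto simp: hat_deriv_def Let_def abs_mult sgn_if divide_right_mono)
    ultimately show ?thesis
      unfolding basis_grad_def using mult_mono[of _ "1 / mesh_size a b m i" _ 1] mesh_size_pos[of i]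
      by (simp add: abs_mult)
  qed
  then show "norm (basis_grad j x) \<le> (\<Sum>i\<in>UNIV. 1 / mesh_size a b m i)"
    by (intro order_trans[OF norm_le_l1_cart] sum_mono)
qed

lemma basis_grad_measurable: "basis_grad j \<in> borel_measurable lebesgue"
proof -
  have [measurable]: "hat a b m i k \<in> borel_measurable borel" for i k
    by (intro borel_measurable_continuous_onI continuous_intros)
  have [measurable]: "hat_deriv a b m i k \<in> borel_measurable borel" for i k
    unfolding hat_deriv_def[abs_def] Let_def sgn_if by measurable
  have "(\<lambda>x. basis_grad j x $ i) \<in> borel_measurable borel" for i
    unfolding basis_grad_def vec_lambda_beta by measurable
  then have "(\<lambda>x. \<chi> i. basis_grad j x $ i) \<in> borel_measurable borel"
    by (subst borel_measurable_euclidean_space) (auto simp: Basis_vec_def inner_axis)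
  then show ?thesis by (simp add: measurable_completion)
qed

lemma set_integrable_grad_inner:
  "set_integrable lebesgue (box a b) (\<lambda>x. basis_grad j x \<bullet> basis_grad k x)"
proof -
  obtain K where K: "\<And>x. norm (basis_grad j x) \<le> K" using norm_basis_grad_bound by blast
  obtain L where L: "\<And>x. norm (basis_grad k x) \<le> L" using norm_basis_grad_bound by blast
  have "norm (basis_grad j x \<bullet> basis_grad k x) \<le> K * L" for x
    using Cauchy_Schwarz_ineq2[of "basis_grad j x" "basis_grad k x"]
      mult_mono[OF K[of x] L[of x]] order_trans[OF norm_ge_zero K[of x]] by simp
  then show ?thesis
    unfolding set_integrable_def
    by (intro integrableI_bounded_set_indicator[where B = "K * L"])
      (auto intro!: borel_measurable_inner basis_grad_measurable
        simp: emeasure_lborel_box_finite[simplified])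
qed

lemma set_integrable_basis_fun: "set_integrable lebesgue (box a b) (\<lambda>x. basis_fun j x * basis_fun k x)"
proof -
  have "norm (basis_fun j x) \<le> 1" for j x
    by (auto simp: basis_fun_def abs_prod hat_nonneg hat_le_1 intro!: prod_le_1)
  then have "norm (basis_fun j x * basis_fun k x) \<le> 1" for x
    using mult_mono[of "norm (basis_fun j x)" 1 "norm (basis_fun k x)" 1] by (simp add: abs_mult)
  moreover have "(\<lambda>x. basis_fun j x * basis_fun k x) \<in> borel_measurable lebesgue"
    by (simp add: measurable_completion borel_measurable_continuous_onI continuous_on_mult
        continuous_on_basis_fun)
  ultimately show ?thesis
    unfolding set_integrable_def
    by (intro integrableI_bounded_set_indicator[where B = 1])
      (auto simp: emeasure_lborel_box_finite[simplified])
qed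

section \<open>The mass and stiffness forms\<close>

lemma set_lebesgue_integral_double_sum:
  fixes E :: "'j \<Rightarrow> 'j \<Rightarrow> real^'d \<Rightarrow> real"
  assumes "\<And>j k. set_integrable lebesgue S (E j k)"
  shows "(LINT x:S|lebesgue. \<Sum>j\<in>I. \<Sum>k\<in>I. c j * d k * E j k x)
       = (\<Sum>j\<in>I. \<Sum>k\<in>I. c j * d k * (LINT x:S|lebesgue. E j k x))"
proof -
  have "integrable lebesgue (\<lambda>x. c j * d k * (indicator S x * E j k x))" for j k
    using assms[of j k] by (intro integrable_mult_right) (simp add: set_integrable_def)
  moreover have "indicator S x * (\<Sum>j\<in>I. \<Sum>k\<in>I. c j * d k * E j k x)
      = (\<Sum>j\<in>I. \<Sum>k\<in>I. c j * d k * (indicator S x * E j k x))" for x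
    by (simp add: sum_distrib_left mult_ac)
  ultimately show ?thesis
    by (simp add: set_lebesgue_integral_def)
qed

lemma L2_inner_comb:
  "L2_inner (box a b) (comb c) (comb d) = (\<Sum>j\<in>J. \<Sum>k\<in>J. c j * d k * mass j k)"
proof -
  have "comb c x * comb d x = (\<Sum>j\<in>J. \<Sum>k\<in>J. c j * d k * (basis_fun j x * basis_fun k x))" for x
    by (simp add: comb_def sum_product mult_ac)
  then show ?thesis
    using set_lebesgue_integral_double_sum[OF set_integrable_basis_fun, where I = J and c = c and d = d]
    by (simp add: L2_inner_def mass_def)
qed

text \<open>Almost everywhere the gradients equal combinations of the explicit
  \<open>basis_grad\<close>, so the integrand may be exchanged for one that is bilinear in the
  coordinates.\<close>

lemma Dirichlet_form_comb:
  "(LINT x:box a b|lebesgue. D * (grad (comb c) x \<bullet> grad (comb d) x))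
     = D * (\<Sum>j\<in>J. \<Sum>k\<in>J. c j * d k * stiffness j k)"
proof -
  have *: "AE x in lebesgue. indicator (box a b) x *\<^sub>R (grad (comb c) x \<bullet> grad (comb d) x)
     = indicator (box a b) x *\<^sub>R (\<Sum>j\<in>J. \<Sum>k\<in>J. c j * d k * (basis_grad j x \<bullet> basis_grad k x))"
    using AE_off_grid
    by eventually_elim (simp add: grad_comb, subst inner_sum_left, simp add: inner_sum_right sum_distrib_left mult_ac)
  then have "(LINT x|lebesgue. indicator (box a b) x *\<^sub>R (grad (comb c) x \<bullet> grad (comb d) x))
    = (LINT x|lebesgue. indicator (box a b) x *\<^sub>R (\<Sum>j\<in>J. \<Sum>k\<in>J. c j * d k * (basis_grad j x \<bullet> basis_grad k x)))"
    (is "integral\<^sup>L _ ?l = integral\<^sup>L _ ?r")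
  proof (rule integral_cong_AE[rotated 2])
    show r: "?r \<in> borel_measurable lebesgue"
      by (auto intro!: borel_measurable_inner basis_grad_measurable borel_measurable_sum
          borel_measurable_times borel_measurable_indicator)
    \<comment> \<open>On the grid hyperplanes the values of \<open>grad\<close> are unspecified; by
      completeness of Lebesgue measure, almost everywhere equality with the measurable
      \<open>?r\<close> suffices.\<close>
    show "?l \<in> borel_measurable lebesgue"
      by (rule borel_measurable_AE[OF r]) (use * in eventually_elim, rule sym)
  qed
  then show ?thesis
    using set_lebesgue_integral_double_sum[OF set_integrable_grad_inner, where I = J and c = c and d = d]
    by (simp add: set_lebesgue_integral_def stiffness_def)
qed

lemma L2_inner_coef:
  assumes "u \<in> Vh a b m" "v \<in> Vh a b m"
  shows "L2_inner (box a b) u v = (\<Sum>j\<in>J. \<Sum>k\<in>J. coef u j * coef v k * mass j k)"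
  using L2_inner_comb[of "coef u" "coef v"] assms by (simp add: comb_coef)

lemma mass_sym: "mass j k = mass k j"
  by (simp add: mass_def L2_inner_def mult.commute)

lemma mass_nonneg: "0 \<le> (\<Sum>j\<in>J. \<Sum>k\<in>J. c j * c k * mass j k)"
  unfolding L2_inner_comb[symmetric] L2_inner_def set_lebesgue_integral_def
  by (intro integral_nonneg_AE) auto

lemma stiffness_nonneg: "0 \<le> (\<Sum>j\<in>J. \<Sum>k\<in>J. c j * c k * stiffness j k)"
proof -
  \<comment> \<open>The factor 1 gives the integral the shape of \<open>Dirichlet_form_comb\<close>
    with \<open>D = 1\<close>.\<close>
  have "0 \<le> (LINT x:box a b|lebesgue. 1 * (grad (comb c) x \<bullet> grad (comb c) x))"
    unfolding set_lebesgue_integral_def by (intro integral_nonneg_AE) auto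
  then show ?thesis unfolding Dirichlet_form_comb by simp
qed

text \<open>A nonnegative integrand with integral zero vanishes almost everywhere; by continuity
  \<open>comb c\<close> then vanishes on the whole open box, and its values at the interior nodes
  are the coefficients.\<close>

lemma mass_pos_def:
  assumes "(\<Sum>j\<in>J. \<Sum>k\<in>J. c j * c k * mass j k) \<le> 0"
  shows "\<forall>j\<in>J. c j = 0"
proof -
  let ?g = "\<lambda>x. indicator (box a b) x *\<^sub>R (comb c x * comb c x)"
  have "?g = (\<lambda>x. \<Sum>j\<in>J. \<Sum>k\<in>J. c j * c k * (indicator (box a b) x *\<^sub>R (basis_fun j x * basis_fun k x)))"
    by (simp add: comb_def sum_product sum_distrib_left mult_ac)
  then have int: "integrable lebesgue ?g"
    using set_integrable_basis_fun unfolding set_integrable_def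
    by (simp only:) (intro Bochner_Integration.integrable_sum integrable_mult_right)
  have "integral\<^sup>L lebesgue ?g = 0"
    using assms mass_nonneg[of c]
    unfolding L2_inner_comb[symmetric] L2_inner_def set_lebesgue_integral_def by linarith
  then have "AE x in lebesgue. ?g x = 0"
    using integral_nonneg_eq_0_iff_AE[OF int] by auto
  then have ae: "AE x \<in> box a b in lebesgue. x \<in> {x. comb c x = 0}"
    by eventually_elim (auto simp: indicator_def)
  have "closed {x. comb c x = 0}"
    by (intro closed_Collect_eq continuous_on_comb continuous_on_const)
  then have "comb c x = 0" if "x \<in> box a b" for x
    using mem_closed_if_AE_lebesgue_open[OF open_box _ ae that] by simp
  then show ?thesis
    using node_in_box coef_comb[of _ c] by (simp add: coef_def)
qed

lemma mass_solvable: "\<exists>z. \<forall>k\<in>J. (\<Sum>j\<in>J. z j * mass j k) = l k"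
  using linear_system_solvable[OF finite_J mass_pos_def] .

text \<open>The mass form of the difference of two solutions vanishes, and the form is
  definite.\<close>

lemma mass_system_unique:
  assumes "\<And>k. k \<in> J \<Longrightarrow> (\<Sum>j\<in>J. z j * mass j k) = (\<Sum>j\<in>J. w j * mass j k)"
    and "j \<in> J"
  shows "z j = w j"
proof -
  define d where "d j = z j - w j" for j
  have "(\<Sum>j\<in>J. \<Sum>k\<in>J. d j * d k * mass j k) = (\<Sum>k\<in>J. d k * (\<Sum>j\<in>J. d j * mass j k))"
    by (subst sum.swap) (simp add: sum_distrib_left mult_ac)
  also have "\<dots> = 0"
    using assms(1) by (simp add: d_def left_diff_distrib sum_subtractf)
  finally show ?thesis using mass_pos_def[of d] assms(2) by (simp add: d_def)
qed

section \<open>The L2 norm on the finite element space\<close>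

lemma L2_norm_nonneg: "v \<in> Vh a b m \<Longrightarrow> 0 \<le> L2_norm (box a b) v"
  using mass_nonneg by (simp add: L2_norm_def L2_inner_coef)

lemma L2_norm_comb: "L2_norm (box a b) (comb c) = sqrt (\<Sum>j\<in>J. \<Sum>k\<in>J. c j * c k * mass j k)"
  by (simp add: L2_norm_def L2_inner_comb)

text \<open>The squared norm along a line is a quadratic polynomial in \<open>r\<close>: its
  nonnegativity gives Cauchy-Schwarz, and its value at \<open>r = 1\<close> the triangle
  inequality.\<close>

lemma L2_inner_expand:
  "L2_inner (box a b) (comb (\<lambda>j. c j + r * d j)) (comb (\<lambda>j. c j + r * d j)) =
     L2_inner (box a b) (comb c) (comb c) + 2 * r * L2_inner (box a b) (comb c) (comb d)
     + r\<^sup>2 * L2_inner (box a b) (comb d) (comb d)"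
proof -
  have sw: "(\<Sum>j\<in>J. \<Sum>k\<in>J. d j * c k * mass j k) = (\<Sum>j\<in>J. \<Sum>k\<in>J. c j * d k * mass j k)"
    by (subst sum.swap, intro sum.cong refl, subst mass_sym) simp
  have "(\<Sum>j\<in>J. \<Sum>k\<in>J. (c j + r * d j) * (c k + r * d k) * mass j k)
     = (\<Sum>j\<in>J. \<Sum>k\<in>J. c j * c k * mass j k + r * (c j * d k * mass j k)
          + r * (d j * c k * mass j k) + r\<^sup>2 * (d j * d k * mass j k))"
    by (intro sum.cong refl) (simp add: algebra_simps power2_eq_square)
  also have "\<dots> = (\<Sum>j\<in>J. \<Sum>k\<in>J. c j * c k * mass j k) + r * (\<Sum>j\<in>J. \<Sum>k\<in>J. c j * d k * mass j k)
     + r * (\<Sum>j\<in>J. \<Sum>k\<in>J. d j * c k * mass j k) + r\<^sup>2 * (\<Sum>j\<in>J. \<Sum>k\<in>J. d j * d k * mass j k)"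
    unfolding sum_distrib_left sum.distrib ..
  finally show ?thesis by (simp add: L2_inner_comb sw)
qed

text \<open>The polynomial \<open>A + 2 * r * B + r\<^sup>2 * C\<close> is nonnegative for every
  \<open>r\<close>, so its discriminant cannot be positive.\<close>

lemma L2_Cauchy_Schwarz:
  "\<bar>L2_inner (box a b) (comb c) (comb d)\<bar> \<le> L2_norm (box a b) (comb c) * L2_norm (box a b) (comb d)"
proof -
  define A where "A = L2_inner (box a b) (comb c) (comb c)"
  define B where "B = L2_inner (box a b) (comb c) (comb d)"
  define C where "C = L2_inner (box a b) (comb d) (comb d)"
  have nonneg: "0 \<le> L2_inner (box a b) (comb e) (comb e)" for e
    by (simp add: L2_inner_comb mass_nonneg)
  have q: "0 \<le> A + 2 * r * B + r\<^sup>2 * C" for r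
    using nonneg[of "\<lambda>j. c j + r * d j"] by (simp add: L2_inner_expand A_def B_def C_def)
  have "B\<^sup>2 \<le> A * C"
  proof (cases "C = 0")
    case True
    have "B = 0"
    proof (rule ccontr)
      assume "B \<noteq> 0"
      \<comment> \<open>With \<open>C = 0\<close> the polynomial is affine in \<open>r\<close>; this
        choice gives it the value -1.\<close>
      define r where "r = - (A + 1) / (2 * B)"
      have "2 * r * B = - (A + 1)" using \<open>B \<noteq> 0\<close> by (simp add: r_def)
      moreover have "r\<^sup>2 * C = 0" using True by simp
      ultimately show False using q[of r] by linarith
    qed
    then show ?thesis using True by simp
  next
    case False
    then have "C > 0" using nonneg[of d] by (simp add: C_def)
    \<comment> \<open>The minimizer of the polynomial.\<close>
    define r where "r = - B / C"
    have rC: "r * C = - B" using \<open>C > 0\<close> by (simp add: r_def)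
    have "0 \<le> (A + 2 * r * B + r\<^sup>2 * C) * C"
      using q[of r] \<open>C > 0\<close> by (intro mult_nonneg_nonneg) auto
    also have "\<dots> = A * C + 2 * (r * C) * B + (r * C)\<^sup>2"
      by (simp add: algebra_simps power2_eq_square)
    also have "\<dots> = A * C - B\<^sup>2"
      unfolding rC by (simp add: power2_eq_square)
    finally show ?thesis by simp
  qed
  then have "\<bar>B\<bar> \<le> sqrt (A * C)"
    using real_le_rsqrt[of "\<bar>B\<bar>"] by simp
  then show ?thesis by (simp add: L2_norm_def A_def B_def C_def real_sqrt_mult)
qed

lemma L2_norm_triangle:
  assumes "u \<in> Vh a b m" "v \<in> Vh a b m"
  shows "L2_norm (box a b) (u + v) \<le> L2_norm (box a b) u + L2_norm (box a b) v"
proof -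
  obtain c d where uv: "u = comb c" "v = comb d" using assms by (auto simp: Vh_eq)
  let ?n = "L2_norm (box a b)"
  have sq: "(?n (comb e))\<^sup>2 = L2_inner (box a b) (comb e) (comb e)" for e
    by (simp add: L2_norm_def L2_inner_comb mass_nonneg)
  have "(?n (u + v))\<^sup>2 = (?n u)\<^sup>2 + 2 * L2_inner (box a b) u v + (?n v)\<^sup>2"
    using L2_inner_expand[of c 1 d] by (simp add: uv comb_add sq)
  also have "\<dots> \<le> (?n u)\<^sup>2 + 2 * (?n u * ?n v) + (?n v)\<^sup>2"
    using L2_Cauchy_Schwarz[of c d] by (simp add: uv)
  also have "\<dots> = (?n u + ?n v)\<^sup>2"
    by (simp add: power2_sum)
  finally show ?thesis
    by (rule power2_le_imp_le) (use assms in \<open>auto intro: add_nonneg_nonneg L2_norm_nonneg\<close>)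
qed

text \<open>One direction is continuity of the norm in the coordinates. For the other, each
  coordinate is a linear functional on a finite-dimensional inner product space and hence bounded by
  a multiple of the norm.\<close>

lemma tendsto_L2_norm_comb_iff:
  "((\<lambda>r. L2_norm (box a b) (comb (e r))) \<longlongrightarrow> 0) F \<longleftrightarrow> (\<forall>j\<in>J. ((\<lambda>r. e r j) \<longlongrightarrow> 0) F)"
proof
  assume lim: "\<forall>j\<in>J. ((\<lambda>r. e r j) \<longlongrightarrow> 0) F"
  have "((\<lambda>r. sqrt (\<Sum>j\<in>J. \<Sum>k\<in>J. e r j * e r k * mass j k)) \<longlongrightarrow> sqrt (\<Sum>j\<in>J. \<Sum>k\<in>J. 0 * 0 * mass j k)) F"
    using lim by (intro tendsto_intros) auto
  then show "((\<lambda>r. L2_norm (box a b) (comb (e r))) \<longlongrightarrow> 0) F"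
    by (simp add: L2_norm_comb)
next
  assume lim: "((\<lambda>r. L2_norm (box a b) (comb (e r))) \<longlongrightarrow> 0) F"
  show "\<forall>j\<in>J. ((\<lambda>r. e r j) \<longlongrightarrow> 0) F"
  proof
    fix i assume i: "i \<in> J"
    \<comment> \<open>\<open>comb z\<close> is the Riesz representer of the coordinate
      \<open>i\<close>; Cauchy-Schwarz then supplies the bound.\<close>
    obtain z where z: "\<And>k. k \<in> J \<Longrightarrow> (\<Sum>j\<in>J. z j * mass j k) = of_bool (k = i)"
      using mass_solvable[of "\<lambda>k. of_bool (k = i)"] by blast
    have "L2_inner (box a b) (comb z) (comb c) = c i" for c
    proof -
      have "L2_inner (box a b) (comb z) (comb c) = (\<Sum>k\<in>J. c k * (\<Sum>j\<in>J. z j * mass j k))"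
        unfolding L2_inner_comb by (subst sum.swap) (simp add: sum_distrib_left mult_ac)
      also have "\<dots> = c i" using z finite_J i by simp
      finally show ?thesis .
    qed
    then have "norm (e r i) \<le> L2_norm (box a b) (comb z) * L2_norm (box a b) (comb (e r))" for r
      using L2_Cauchy_Schwarz[of z "e r"] by simp
    then show "((\<lambda>r. e r i) \<longlongrightarrow> 0) F"
      by (intro Lim_null_comparison[OF _ tendsto_mult_right_zero[OF lim]] always_eventually allI)
  qed
qed

subsection \<open>The semi-discrete problem\<close>

text \<open>The difference quotient minus \<open>y'\<close> lies in \<open>Vh\<close>, with
  coordinates obtained from the difference quotients of the coordinates, so convergence can be read
  off coordinatewise.\<close>

lemma has_L2_derivative_iff_coef:
  assumes "\<And>r. r \<in> I \<Longrightarrow> y r \<in> Vh a b m" "t \<in> I" "y' \<in> Vh a b m"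
  shows "has_L2_derivative (box a b) y y' t I \<longleftrightarrow>
    (\<forall>j\<in>J. ((\<lambda>r. coef (y r) j) has_real_derivative coef y' j) (at t within I))"
proof -
  let ?e = "\<lambda>r j. (coef (y r) j - coef (y t) j) / (r - t) - coef y' j"
  have "(\<lambda>x. (y r x - y t x) / (r - t) - y' x) = comb (?e r)" if "r \<in> I" for r
  proof -
    have "comb (?e r) x = (comb (coef (y r)) x - comb (coef (y t)) x) / (r - t) - comb (coef y') x" for x
      by (simp add: comb_def left_diff_distrib sum_subtractf sum_divide_distrib diff_divide_distrib)
    then show ?thesis using assms that by (simp add: comb_coef fun_eq_iff)
  qed
  then have "has_L2_derivative (box a b) y y' t I \<longleftrightarrow>
     ((\<lambda>r. L2_norm (box a b) (comb (?e r))) \<longlongrightarrow> 0) (at t within I)"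
    unfolding has_L2_derivative_def
    by (intro filterlim_cong refl) (auto simp: eventually_at_filter)
  also have "\<dots> \<longleftrightarrow> (\<forall>j\<in>J. ((\<lambda>r. coef (y r) j) has_real_derivative coef y' j) (at t within I))"
    unfolding tendsto_L2_norm_comb_iff has_field_derivative_iff LIM_zero_iff ..
  finally show ?thesis .
qed

text \<open>Both sides are linear in the test function, so testing against all of \<open>Vh\<close>
  amounts to testing against the nodal basis.\<close>

lemma Lh_weak_form_iff:
  "(\<forall>v\<in>Vh a b m. L2_inner (box a b) (comb z) v =
      (LINT x:box a b|lebesgue. D * (grad (comb w) x \<bullet> grad v x)))
   \<longleftrightarrow> (\<forall>k\<in>J. (\<Sum>j\<in>J. z j * mass j k) = D * (\<Sum>j\<in>J. w j * stiffness j k))"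
  (is "?L \<longleftrightarrow> ?R")
proof -
  let ?l = "\<lambda>k. (\<Sum>j\<in>J. z j * mass j k)" and ?r = "\<lambda>k. D * (\<Sum>j\<in>J. w j * stiffness j k)"
  have l: "L2_inner (box a b) (comb z) (comb d) = (\<Sum>k\<in>J. d k * ?l k)" for d
    unfolding L2_inner_comb by (subst sum.swap) (simp add: sum_distrib_left mult_ac)
  have r: "(LINT x:box a b|lebesgue. D * (grad (comb w) x \<bullet> grad (comb d) x)) = (\<Sum>k\<in>J. d k * ?r k)" for d
    unfolding Dirichlet_form_comb by (subst sum.swap) (simp add: sum_distrib_left mult_ac)
  have "?L \<longleftrightarrow> (\<forall>d. (\<Sum>k\<in>J. d k * ?l k) = (\<Sum>k\<in>J. d k * ?r k))"
    unfolding Vh_eq by (simp only: ball_simps ball_UNIV l r)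
  also have "\<dots> \<longleftrightarrow> ?R"
  proof (intro iffI ballI)
    fix i assume i: "i \<in> J" and "\<forall>d. (\<Sum>k\<in>J. d k * ?l k) = (\<Sum>k\<in>J. d k * ?r k)"
    from this(2)[rule_format, of "\<lambda>k. of_bool (k = i)"] show "?l i = ?r i"
      using i finite_J by simp
  qed simp
  finally show ?thesis .
qed

text \<open>Any function satisfying the weak form has coordinates solving the same mass system, so
  the definite description has \<open>comb z\<close> as its only candidate.\<close>

lemma Lh_comb:
  assumes "\<And>k. k \<in> J \<Longrightarrow> (\<Sum>j\<in>J. z j * mass j k) = D * (\<Sum>j\<in>J. w j * stiffness j k)"
  shows "Lh D a b m (comb w) = comb z"
  unfolding Lh_def
proof (rule the_equality)
  show "comb z \<in> Vh a b m \<and> (\<forall>v\<in>Vh a b m. L2_inner (box a b) (comb z) v =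
      (LINT x:box a b|lebesgue. D * (grad (comb w) x \<bullet> grad v x)))"
    using assms comb_in_Vh unfolding Lh_weak_form_iff by blast
next
  fix z' assume z': "z' \<in> Vh a b m \<and> (\<forall>v\<in>Vh a b m. L2_inner (box a b) z' v =
      (LINT x:box a b|lebesgue. D * (grad (comb w) x \<bullet> grad v x)))"
  then obtain c where c: "z' = comb c" by (auto simp: Vh_eq)
  with z' have "\<forall>k\<in>J. (\<Sum>j\<in>J. c j * mass j k) = D * (\<Sum>j\<in>J. w j * stiffness j k)"
    unfolding c Lh_weak_form_iff by blast
  then have "(\<Sum>j\<in>J. c j * mass j k) = (\<Sum>j\<in>J. z j * mass j k)" if "k \<in> J" for k
    using that assms by simp
  then show "z' = comb z"
    unfolding c using mass_system_unique[of c z] by (intro comb_cong) blast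
qed

text \<open>Solvability of the mass system guarantees that the definite description in
  \<open>Lh\<close> denotes.\<close>

lemma Lh_characterization:
  assumes "v \<in> Vh a b m"
  shows "Lh D a b m v \<in> Vh a b m"
    and "\<And>k. k \<in> J \<Longrightarrow> (\<Sum>j\<in>J. coef (Lh D a b m v) j * mass j k)
                   = D * (\<Sum>j\<in>J. coef v j * stiffness j k)"
proof -
  obtain z where z: "\<And>k. k \<in> J \<Longrightarrow> (\<Sum>j\<in>J. z j * mass j k) = D * (\<Sum>j\<in>J. coef v j * stiffness j k)"
    using mass_solvable[of "\<lambda>k. D * (\<Sum>j\<in>J. coef v j * stiffness j k)"] by blast
  then have "Lh D a b m v = comb z"
    using Lh_comb[of z D "coef v"] assms by (simp add: comb_coef)
  then show "Lh D a b m v \<in> Vh a b m"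
    and "\<And>k. k \<in> J \<Longrightarrow> (\<Sum>j\<in>J. coef (Lh D a b m v) j * mass j k)
                   = D * (\<Sum>j\<in>J. coef v j * stiffness j k)"
    using z by (simp_all add: comb_in_Vh coef_comb)
qed

lemma Lh_add:
  assumes "u \<in> Vh a b m" "v \<in> Vh a b m"
  shows "Lh D a b m (u + v) = Lh D a b m u + Lh D a b m v"
proof -
  let ?z = "\<lambda>j. coef (Lh D a b m u) j + coef (Lh D a b m v) j"
  have "Lh D a b m (comb (coef (u + v))) = comb ?z"
    by (rule Lh_comb) (simp add: coef_add Lh_characterization assms distrib_right sum.distrib distrib_left)
  also have "\<dots> = Lh D a b m u + Lh D a b m v"
    using assms by (simp add: comb_add[symmetric] comb_coef Lh_characterization)
  finally show ?thesis using assms by (simp add: comb_coef Vh_add)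
qed

text \<open>The forcing cancels in the difference of two solutions. Its squared norm
  \<open>E\<close> has derivative \<open>- 2 * D\<close> times the stiffness form, so it cannot grow
  from its initial value 0, and definiteness of the mass form makes the difference vanish at
  \<open>e\<close>.\<close>

lemma semidiscrete_solution_unique:
  assumes y: "semidiscrete_solution D a b m f s e y" and z: "semidiscrete_solution D a b m f s e z"
    and "y s = z s" "s \<le> e" "0 \<le> D"
  shows "y e = z e"
proof -
  define c where "c t j = coef (y t) j - coef (z t) j" for t j
  define E where "E t = (\<Sum>j\<in>J. \<Sum>k\<in>J. c t j * c t k * mass j k)" for t
  have dE: "\<exists>E'. (E has_real_derivative E') (at t within {s..e}) \<and> E' \<le> 0" if t: "t \<in> {s..e}" for t
  proof -
    obtain y' where y': "y' \<in> Vh a b m" "has_L2_derivative (box a b) y y' t {s..e}"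
      "y' + Lh D a b m (y t) = Ph a b m (f t)" and yV: "\<And>t. t \<in> {s..e} \<Longrightarrow> y t \<in> Vh a b m"
      using y t unfolding semidiscrete_solution_def by blast
    obtain z' where z': "z' \<in> Vh a b m" "has_L2_derivative (box a b) z z' t {s..e}"
      "z' + Lh D a b m (z t) = Ph a b m (f t)" and zV: "\<And>t. t \<in> {s..e} \<Longrightarrow> z t \<in> Vh a b m"
      using z t unfolding semidiscrete_solution_def by blast
    define c' where "c' j = coef y' j - coef z' j" for j
    have "\<forall>j\<in>J. ((\<lambda>r. coef (y r) j) has_real_derivative coef y' j) (at t within {s..e})"
      using y'(2) has_L2_derivative_iff_coef[of "{s..e}" y t y', OF yV t y'(1)] by blast
    moreover have "\<forall>j\<in>J. ((\<lambda>r. coef (z r) j) has_real_derivative coef z' j) (at t within {s..e})"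
      using z'(2) has_L2_derivative_iff_coef[of "{s..e}" z t z', OF zV t z'(1)] by blast
    ultimately have c: "((\<lambda>t. c t j) has_real_derivative c' j) (at t within {s..e})" if "j \<in> J" for j
      unfolding c_def c'_def using that by (intro DERIV_diff) auto
    have "coef y' j + coef (Lh D a b m (y t)) j = coef z' j + coef (Lh D a b m (z t)) j" for j
      using y'(3) z'(3) by (metis coef_add)
    then have "c' j = coef (Lh D a b m (z t)) j - coef (Lh D a b m (y t)) j" for j
      by (simp add: c'_def algebra_simps)
    then have c'_mass: "(\<Sum>j\<in>J. c' j * mass j k) = - D * (\<Sum>j\<in>J. c t j * stiffness j k)" if "k \<in> J" for k
      using that Lh_characterization[OF yV[OF t]] Lh_characterization[OF zV[OF t]]
      by (simp add: left_diff_distrib sum_subtractf c_def right_diff_distrib)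
    have "(E has_real_derivative (\<Sum>j\<in>J. \<Sum>k\<in>J. (c' j * c t k + c t j * c' k) * mass j k)) (at t within {s..e})"
      unfolding E_def[abs_def]
      by (intro DERIV_sum) (auto intro!: derivative_eq_intros c)
    moreover have "(\<Sum>j\<in>J. \<Sum>k\<in>J. (c' j * c t k + c t j * c' k) * mass j k)
       = 2 * (\<Sum>k\<in>J. c t k * (\<Sum>j\<in>J. c' j * mass j k))"
    proof -
      have "(\<Sum>j\<in>J. \<Sum>k\<in>J. c' j * c t k * mass j k) = (\<Sum>k\<in>J. c t k * (\<Sum>j\<in>J. c' j * mass j k))"
        by (subst sum.swap) (simp add: sum_distrib_left mult_ac)
      moreover have "(\<Sum>j\<in>J. \<Sum>k\<in>J. c t j * c' k * mass j k) = (\<Sum>k\<in>J. c t k * (\<Sum>j\<in>J. c' j * mass j k))"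
        unfolding sum_distrib_left by (intro sum.cong refl, subst mass_sym) simp
      ultimately show ?thesis by (simp add: distrib_right sum.distrib)
    qed
    moreover have "(\<Sum>k\<in>J. c t k * (\<Sum>j\<in>J. c' j * mass j k)) = - D * (\<Sum>j\<in>J. \<Sum>k\<in>J. c t j * c t k * stiffness j k)"
      by (subst sum.swap) (simp add: c'_mass sum_distrib_left mult_ac sum_negf)
    ultimately show ?thesis
      using stiffness_nonneg[of "c t"] \<open>0 \<le> D\<close> by (auto simp: mult_nonneg_nonneg intro!: exI)
  qed
  \<comment> \<open>Two-sided derivatives are at hand only in the open interval; at the endpoints
    the one-sided ones supply continuity.\<close>
  have "E e \<le> E s"
  proof (rule DERIV_nonpos_imp_decreasing_open[OF \<open>s \<le> e\<close>])
    show "\<exists>E'. (E has_real_derivative E') (at t) \<and> E' \<le> 0" if "s < t" "t < e" for t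
      using dE[of t] that by (simp add: at_within_Icc_at)
    show "continuous_on {s..e} E"
      using dE DERIV_continuous by (fastforce simp: continuous_on_eq_continuous_within)
  qed
  moreover have "E s = 0" using \<open>y s = z s\<close> by (simp add: E_def c_def)
  ultimately have "\<forall>j\<in>J. c e j = 0" using mass_pos_def[of "c e"] by (simp add: E_def)
  then have "comb (coef (y e)) = comb (coef (z e))" by (intro comb_cong) (simp add: c_def)
  moreover have "y e \<in> Vh a b m" "z e \<in> Vh a b m"
    using y z \<open>s \<le> e\<close> by (auto simp: semidiscrete_solution_def)
  ultimately show ?thesis by (simp add: comb_coef)
qed

text \<open>Superposition: \<open>u\<close> carries the forcing on the subinterval, and a solution
  of the homogeneous problem with initial value \<open>v - u s\<close> corrects the starting
  value.\<close>

lemma semidiscrete_solution_exists: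
  assumes u: "semidiscrete_solution D a b m f t0 t1 u" and "t0 \<le> s" "s \<le> e" "e \<le> t1" "v \<in> Vh a b m"
  shows "\<exists>y. semidiscrete_solution D a b m f s e y \<and> y s = v"
proof -
  have "\<forall>i. \<exists>z. \<forall>k\<in>J. (\<Sum>j\<in>J. z j * mass j k) = D * stiffness i k"
    by (intro allI mass_solvable)
  \<comment> \<open>\<open>B i\<close> holds the coordinates of \<open>Lh\<close> applied to the
    basis function \<open>i\<close>, which is why the differential system below sums over the first
    index of \<open>B\<close>.\<close>
  from choice[OF this] obtain B
    where B: "\<And>i k. k \<in> J \<Longrightarrow> (\<Sum>j\<in>J. B i j * mass j k) = D * stiffness i k"
    by blast
  obtain c where c0: "\<And>j. j \<in> J \<Longrightarrow> c 0 j = coef (v - u s) j"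
    and c: "\<And>t j. j \<in> J \<Longrightarrow> ((\<lambda>t. c t j) has_real_derivative (\<Sum>k\<in>J. - B k j * c t k)) (at t)"
    using linear_ode_solution_exists[OF finite_J, of "coef (v - u s)" "\<lambda>j k. - B k j"] by blast
  define c' where "c' t j = (\<Sum>k\<in>J. - B k j * c t k)" for t j
  \<comment> \<open>The time shift lets the homogeneous part start at \<open>s\<close>.\<close>
  define y where "y t = u t + comb (c (t - s))" for t
  have "comb (c' t) + Lh D a b m (comb (c t)) = 0" for t
  proof -
    have "Lh D a b m (comb (c t)) = comb (\<lambda>j. - c' t j)"
    proof (rule Lh_comb)
      fix k assume k: "k \<in> J"
      have "(\<Sum>j\<in>J. - c' t j * mass j k) = (\<Sum>j\<in>J. \<Sum>i\<in>J. c t i * (B i j * mass j k))"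
        by (simp add: c'_def sum_distrib_left sum_negf mult_ac)
      also have "\<dots> = (\<Sum>i\<in>J. c t i * (\<Sum>j\<in>J. B i j * mass j k))"
        unfolding sum_distrib_left by (rule sum.swap)
      finally show "(\<Sum>j\<in>J. - c' t j * mass j k) = D * (\<Sum>j\<in>J. c t j * stiffness j k)"
        using B k by (simp add: sum_distrib_left mult_ac)
    qed
    then show ?thesis by (simp add: comb_add) (simp add: comb_def fun_eq_iff)
  qed
  note homogeneous = this
  have sub: "{s..e} \<subseteq> {t0..t1}" using assms by auto
  have uV: "u t \<in> Vh a b m" if "t \<in> {s..e}" for t
    using u sub that by (auto simp: semidiscrete_solution_def)
  have yV: "y t \<in> Vh a b m" if "t \<in> {s..e}" for t
    using uV that by (simp add: y_def Vh_add comb_in_Vh)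
  have "semidiscrete_solution D a b m f s e y"
    unfolding semidiscrete_solution_def
  proof (intro ballI conjI yV)
    fix t assume t: "t \<in> {s..e}"
    then have "t \<in> {t0..t1}" using sub by blast
    with u obtain u' where u': "u' \<in> Vh a b m" "has_L2_derivative (box a b) u u' t {t0..t1}"
      "u' + Lh D a b m (u t) = Ph a b m (f t)"
      unfolding semidiscrete_solution_def by blast
    have "has_L2_derivative (box a b) u u' t {s..e}"
      using u'(2) tendsto_within_subset[OF _ sub] unfolding has_L2_derivative_def by blast
    then have u'_coef: "((\<lambda>r. coef (u r) j) has_real_derivative coef u' j) (at t within {s..e})"
      if "j \<in> J" for j
      using has_L2_derivative_iff_coef[of "{s..e}" u t u', OF uV t u'(1)] that by blast
    let ?y' = "u' + comb (c' (t - s))"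
    have y'V: "?y' \<in> Vh a b m" using u' by (simp add: Vh_add comb_in_Vh)
    have "((\<lambda>r. coef (y r) j) has_real_derivative coef ?y' j) (at t within {s..e})" if "j \<in> J" for j
    proof -
      have "((\<lambda>r. c (r - s) j) has_real_derivative c' (t - s) j * 1) (at t within {s..e})"
        by (rule DERIV_chain2[OF c[OF that, folded c'_def]]) (auto intro!: derivative_eq_intros)
      then show ?thesis
        using DERIV_add[OF u'_coef[OF that]] that by (simp add: y_def coef_add coef_comb)
    qed
    then have "has_L2_derivative (box a b) y ?y' t {s..e}"
      using has_L2_derivative_iff_coef[of "{s..e}" y t ?y', OF yV t y'V] by blast
    moreover have "?y' + Lh D a b m (y t) = Ph a b m (f t)"
    proof -
      have "?y' + Lh D a b m (y t)
         = (u' + Lh D a b m (u t)) + (comb (c' (t - s)) + Lh D a b m (comb (c (t - s))))"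
        unfolding y_def Lh_add[OF uV[OF t] comb_in_Vh] by (simp only: add_ac)
      then show ?thesis by (simp add: u' homogeneous)
    qed
    ultimately show "\<exists>y'\<in>Vh a b m. has_L2_derivative (box a b) y y' t {s..e} \<and>
        y' + Lh D a b m (y t) = Ph a b m (f t)"
      using y'V by blast
  qed
  moreover have "y s = v"
  proof -
    have "u s \<in> Vh a b m" using uV \<open>s \<le> e\<close> by simp
    then have "comb (c 0) = v - u s"
      using comb_cong[OF c0] by (simp add: comb_coef Vh_diff assms)
    then show ?thesis by (simp add: y_def)
  qed
  ultimately show ?thesis by blast
qed

text \<open>By uniqueness, the definite description denotes the end value of whichever solution is
  given.\<close>

lemma exact_propagator_eq:
  assumes "semidiscrete_solution D a b m f s e y" "s \<le> e" "0 \<le> D"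
  shows "exact_propagator D a b m f (y s) s e = y e"
  unfolding exact_propagator_def
proof (rule the_equality)
  show "\<exists>z. semidiscrete_solution D a b m f s e z \<and> z s = y s \<and> z e = y e"
    using assms(1) by blast
  show "w = y e" if "\<exists>z. semidiscrete_solution D a b m f s e z \<and> z s = y s \<and> z e = w" for w
    using that semidiscrete_solution_unique[OF _ assms(1) _ assms(2,3)] by blast
qed

lemma semidiscrete_solution_subinterval:
  assumes "semidiscrete_solution D a b m f t0 t1 u" "t0 \<le> s" "e \<le> t1"
  shows "semidiscrete_solution D a b m f s e u"
proof -
  have sub: "{s..e} \<subseteq> {t0..t1}" using assms by auto
  then show ?thesis
    using assms(1) tendsto_within_subset[OF _ sub]
    unfolding semidiscrete_solution_def has_L2_derivative_def by blast
qed

text \<open>Existence from every starting value in \<open>Vh\<close> keeps the definite description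
  inside the space, so that norms of differences obey the triangle inequality.\<close>

lemma exact_propagator_in_Vh:
  assumes "semidiscrete_solution D a b m f t0 t1 u" "t0 \<le> s" "s \<le> e" "e \<le> t1" "0 \<le> D"
    and "v \<in> Vh a b m"
  shows "exact_propagator D a b m f v s e \<in> Vh a b m"
proof -
  obtain y where y: "semidiscrete_solution D a b m f s e y" "y s = v"
    using semidiscrete_solution_exists assms by blast
  then have "exact_propagator D a b m f v s e = y e"
    using exact_propagator_eq assms by blast
  then show ?thesis using y \<open>s \<le> e\<close> by (simp add: semidiscrete_solution_def)
qed

end

subsection \<open>The Parareal iteration\<close>

text \<open>Each step uses \<open>1 + x \<le> exp x\<close> and enlarges the new contribution
  \<open>r\<close> to \<open>r * exp (real (Suc n) * x)\<close>, which makes all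
  \<open>Suc n\<close> contributions equal.\<close>

lemma discrete_Gronwall:
  fixes err :: "nat \<Rightarrow> real"
  assumes step: "\<And>n. n < N \<Longrightarrow> err (Suc n) \<le> (1 + x) * err n + r"
    and "err 0 \<le> 0" "0 \<le> x" "0 \<le> r" "n \<le> N"
  shows "err n \<le> real n * r * exp (real n * x)"
  using \<open>n \<le> N\<close>
proof (induction n)
  case 0
  then show ?case using \<open>err 0 \<le> 0\<close> by simp
next
  case (Suc n)
  have "err (Suc n) \<le> (1 + x) * err n + r" using Suc.prems by (intro step) simp
  also have "\<dots> \<le> exp x * (real n * r * exp (real n * x)) + r * exp (real (Suc n) * x)"
  proof (rule add_mono)
    have "(1 + x) * err n \<le> (1 + x) * (real n * r * exp (real n * x))"
      using Suc \<open>0 \<le> x\<close> by (intro mult_left_mono) auto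
    also have "\<dots> \<le> exp x * (real n * r * exp (real n * x))"
      using \<open>0 \<le> r\<close> by (intro mult_right_mono exp_ge_add_one_self) auto
    finally show "(1 + x) * err n \<le> exp x * (real n * r * exp (real n * x))" .
    show "r \<le> r * exp (real (Suc n) * x)"
      using mult_left_mono[of 1 "exp (real (Suc n) * x)" r] \<open>0 \<le> r\<close> \<open>0 \<le> x\<close> by simp
  qed
  also have "\<dots> = real (Suc n) * r * exp (real (Suc n) * x)"
    by (simp add: algebra_simps exp_add)
  finally show ?case .
qed

text \<open>For \<open>k = Suc k'\<close> with \<open>n \<le> k'\<close>, the iterates at
  \<open>n\<close> agree for \<open>k'\<close>, \<open>Suc k'\<close> and
  \<open>Suc (Suc k')\<close>; the recursions for the two sides at \<open>Suc n\<close> then have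
  the same arguments.\<close>

lemma parareal_stationary:
  "n \<le> k \<Longrightarrow> parareal g fM v n (Suc k) = parareal g fM v n k"
proof (induction n arbitrary: k)
  case (Suc n)
  then obtain k' where k: "k = Suc k'" "n \<le> k'" by (cases k) auto
  have "parareal g fM v n (Suc (Suc k')) = parareal g fM v n (Suc k')"
    "parareal g fM v n (Suc k') = parareal g fM v n k'"
    using Suc.IH k(2) by auto
  then show ?case by (simp add: k)
qed simp

text \<open>The iterate at \<open>n\<close> does not change from \<open>k - 1\<close> to
  \<open>k\<close>, so the two coarse terms cancel. Strictness of \<open>n < k\<close> is what gives
  \<open>n \<le> k - 1\<close>.\<close>

lemma parareal_eq_fine:
  assumes "n < k"
  shows "parareal g fM v (Suc n) k = fM n (parareal g fM v n k)"
proof -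
  obtain k' where k: "k = Suc k'" "n \<le> k'" using assms by (cases k) auto
  then show ?thesis using parareal_stationary[OF k(2), of g fM v] by simp
qed

section \<open>The time grid and the iterated fine steps\<close>

lemma coarse_time_eq:
  assumes "valid_discretization \<delta>"
  shows "coarse_time t0 T \<delta> n = t0 + real n * coarse_step T \<delta>"
  using assms by (simp add: valid_discretization_def coarse_time_def fine_time_def fine_step_def coarse_step_def)

lemma fine_propagator_closed:
  assumes F: "\<And>v l. v \<in> V \<Longrightarrow> l < num_coarse \<delta> * num_fine \<delta> \<Longrightarrow>
      F v (fine_time t0 T \<delta> l) (fine_time t0 T \<delta> (Suc l)) \<in> V"
    and "v \<in> V" "n < num_coarse \<delta>"
  shows "fine_propagator t0 T \<delta> F n v \<in> V"
proof -
  have "fine_iterate t0 T \<delta> F (n * num_fine \<delta>) j v \<in> V" if "j \<le> num_fine \<delta>" for j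
    using that
  proof (induction j)
    case (Suc j)
    \<comment> \<open>The global index of the fine step stays on the grid, where \<open>F\<close> is
      known to preserve \<open>V\<close>.\<close>
    have "n * num_fine \<delta> + j < Suc n * num_fine \<delta>" using Suc.prems by simp
    also have "\<dots> \<le> num_coarse \<delta> * num_fine \<delta>"
      using \<open>n < num_coarse \<delta>\<close> by (intro mult_right_mono) auto
    finally show ?case using F Suc by simp
  qed (use \<open>v \<in> V\<close> in simp)
  then show ?thesis by (simp add: fine_propagator_def)
qed

section \<open>Error of the Parareal iterates from iteration \<open>N\<close> on\<close>

theorem theorem4p3:
  fixes a b :: "real^'d" and t0 T D :: real
    and u0 :: "real^'d \<Rightarrow> real" and f :: "real \<Rightarrow> real^'d \<Rightarrow> real"
    and \<S> :: "'d discretization set"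
    and G F :: "'d discretization \<Rightarrow> 'd propagator"
    and uh :: "('d \<Rightarrow> nat) \<Rightarrow> real \<Rightarrow> real^'d \<Rightarrow> real"
    and p q :: nat
  defines "\<Omega> \<equiv> box a b"
    and "V \<equiv> \<lambda>\<delta>. Vh a b (cells \<delta>)"
    and "\<G> \<equiv> \<lambda>\<delta>. over_coarse t0 T \<delta> (G \<delta>)"
    and "\<F>M \<equiv> \<lambda>\<delta>. fine_propagator t0 T \<delta> (F \<delta>)"
    and "\<H> \<equiv> \<lambda>\<delta>. over_coarse t0 T \<delta> (exact_propagator D a b (cells \<delta>) f)"
  assumes "\<forall>i. a $ i < b $ i"
    and "0 < T" and "0 < D" and "1 \<le> p" and "1 \<le> q"
    and "u0 \<in> H2 \<Omega> \<inter> H10 \<Omega>"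
    and "\<forall>t\<in>{t0..t0 + T}. f t \<in> L2 \<Omega>"
    and "\<forall>\<delta>\<in>\<S>. valid_discretization \<delta>"
    and "\<exists>\<kappa>>0. \<forall>\<delta>\<in>\<S>. \<forall>i. max_mesh_size a b (cells \<delta>) \<le> \<kappa> * mesh_size a b (cells \<delta>) i"
    and "\<forall>\<delta>\<in>\<S>. semidiscrete_solution D a b (cells \<delta>) f t0 (t0 + T) (uh (cells \<delta>)) \<and>
               uh (cells \<delta>) t0 = Ph a b (cells \<delta>) u0"
    and "\<forall>\<delta>\<in>\<S>. \<forall>v\<in>V \<delta>. \<forall>n<num_coarse \<delta>. \<G> \<delta> n v \<in> V \<delta>"
    and "\<forall>\<delta>\<in>\<S>. \<forall>v\<in>V \<delta>. \<forall>l<num_coarse \<delta> * num_fine \<delta>.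
           F \<delta> v (fine_time t0 T \<delta> l) (fine_time t0 T \<delta> (Suc l)) \<in> V \<delta>"
    and "\<exists>C>0. \<forall>\<delta>\<in>\<S>. \<forall>v\<in>V \<delta>.
           (MAX n\<in>{..<num_coarse \<delta>}. L2_norm \<Omega> (\<F>M \<delta> n v - \<H> \<delta> n v))
             \<le> C * fine_step T \<delta> ^ (q + 1)"
    and "\<exists>C>0. \<forall>\<delta>\<in>\<S>. \<forall>v\<in>V \<delta>.
           (MAX n\<in>{..<num_coarse \<delta>}. L2_norm \<Omega> (\<G> \<delta> n v - \<H> \<delta> n v))
             \<le> C * coarse_step T \<delta> ^ (p + 1)"
    and "\<exists>C>0. \<forall>\<delta>\<in>\<S>. \<forall>v\<in>V \<delta>. \<forall>w\<in>V \<delta>. \<forall>n<num_coarse \<delta>.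
           L2_norm \<Omega> (\<G> \<delta> n v - \<G> \<delta> n w) - L2_norm \<Omega> (v - w)
             \<le> C * (coarse_step T \<delta> * L2_norm \<Omega> (v - w))"
    and "\<exists>C>0. \<forall>\<delta>\<in>\<S>. \<forall>v\<in>V \<delta>. \<forall>w\<in>V \<delta>. \<forall>\<xi>\<in>V \<delta>. \<forall>n<num_coarse \<delta>.
           L2_norm \<Omega> (\<G> \<delta> n v - \<G> \<delta> n w + \<H> \<delta> n w - \<H> \<delta> n \<xi>) - L2_norm \<Omega> (v - \<xi>)
             \<le> C * (coarse_step T \<delta> * L2_norm \<Omega> (v - \<xi>)
                    + coarse_step T \<delta> ^ (p + 1) * L2_norm \<Omega> (w - \<xi>))"
  shows "\<exists>C>0. \<forall>\<delta>\<in>\<S>. \<forall>k\<ge>num_coarse \<delta>. \<forall>n\<le>num_coarse \<delta>.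
           L2_norm \<Omega> (parareal (\<G> \<delta>) (\<F>M \<delta>) (Ph a b (cells \<delta>) u0) n k
                        - uh (cells \<delta>) (coarse_time t0 T \<delta> n))
             \<le> C * fine_step T \<delta> ^ q"
proof -
  obtain C1 where "C1 > 0" and C1: "\<And>\<delta> v. \<delta> \<in> \<S> \<Longrightarrow> v \<in> V \<delta> \<Longrightarrow>
      (MAX n\<in>{..<num_coarse \<delta>}. L2_norm \<Omega> (\<F>M \<delta> n v - \<H> \<delta> n v)) \<le> C1 * fine_step T \<delta> ^ (q + 1)"
    using assms(18) by blast
  obtain C3 where "C3 > 0" and C3: "\<And>\<delta> v w \<xi> n. \<delta> \<in> \<S> \<Longrightarrow> v \<in> V \<delta> \<Longrightarrow> w \<in> V \<delta> \<Longrightarrow> \<xi> \<in> V \<delta> \<Longrightarrow>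
      n < num_coarse \<delta> \<Longrightarrow>
      L2_norm \<Omega> (\<G> \<delta> n v - \<G> \<delta> n w + \<H> \<delta> n w - \<H> \<delta> n \<xi>) - L2_norm \<Omega> (v - \<xi>)
        \<le> C3 * (coarse_step T \<delta> * L2_norm \<Omega> (v - \<xi>) + coarse_step T \<delta> ^ (p + 1) * L2_norm \<Omega> (w - \<xi>))"
    using assms(21) by blast
  \<comment> \<open>Absorbs both terms of the stability condition: a coarse step
    \<open>\<tau> \<le> T\<close> satisfies
    \<open>\<tau> ^ (p + 1) \<le> T ^ p * \<tau>\<close>.\<close>
  define K where "K = C3 * (1 + T ^ p)"
  have "K > 0" using \<open>C3 > 0\<close> \<open>0 < T\<close> by (simp add: K_def add_pos_nonneg)
  \<comment> \<open>The factor \<open>T\<close> bounds \<open>N\<close> times the fine step, and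
    \<open>exp (K * T)\<close> is the Gronwall growth over \<open>N\<close> coarse steps of total
    length \<open>T\<close>. The constant depends only on \<open>C1\<close>, \<open>C3\<close>,
    \<open>p\<close> and \<open>T\<close>, hence not on \<open>\<delta>\<close>.\<close>
  have bound: "L2_norm \<Omega> (parareal (\<G> \<delta>) (\<F>M \<delta>) (Ph a b (cells \<delta>) u0) n k
        - uh (cells \<delta>) (coarse_time t0 T \<delta> n)) \<le> C1 * T * exp (K * T) * fine_step T \<delta> ^ q"
    if \<delta>: "\<delta> \<in> \<S>" and k: "num_coarse \<delta> \<le> k" and n: "n \<le> num_coarse \<delta>" for \<delta> k n
  proof -
    define N where "N = num_coarse \<delta>"
    define \<tau> where "\<tau> = coarse_step T \<delta>"
    define U where "U n = parareal (\<G> \<delta>) (\<F>M \<delta>) (Ph a b (cells \<delta>) u0) n k" for n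
    define u where "u n = uh (cells \<delta>) (coarse_time t0 T \<delta> n)" for n
    have valid: "valid_discretization \<delta>" using assms(13) \<delta> by blast
    interpret finite_element_space a b "cells \<delta>"
      using assms(6) valid by unfold_locales (auto simp: valid_discretization_def)
    have "N \<ge> 1" using valid by (simp add: valid_discretization_def N_def)
    have \<tau>: "\<tau> > 0" "\<tau> \<le> T" "real N * \<tau> = T"
      using \<open>N \<ge> 1\<close> \<open>0 < T\<close> by (auto simp: \<tau>_def coarse_step_def N_def[symmetric] field_simps)
    have time: "coarse_time t0 T \<delta> n = t0 + real n * \<tau>" for n
      using coarse_time_eq[OF valid] by (simp add: \<tau>_def)
    have uh: "semidiscrete_solution D a b (cells \<delta>) f t0 (t0 + T) (uh (cells \<delta>))"
      "uh (cells \<delta>) t0 = Ph a b (cells \<delta>) u0"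
      using assms(15) \<delta> by auto
    have times: "t0 \<le> coarse_time t0 T \<delta> n" "coarse_time t0 T \<delta> n \<le> coarse_time t0 T \<delta> (Suc n)" for n
      using \<tau>(1) by (simp_all add: time algebra_simps)
    have time_le: "coarse_time t0 T \<delta> n \<le> t0 + T" if "n \<le> N" for n
      using mult_right_mono[of "real n" "real N" \<tau>] \<tau> that by (simp add: time)
    have uV: "u n \<in> V \<delta>" if "n \<le> N" for n
      using uh(1) times(1)[of n] time_le[OF that]
      by (simp add: u_def V_def semidiscrete_solution_def)
    have H_V: "\<H> \<delta> n v \<in> V \<delta>" if "n < N" "v \<in> V \<delta>" for n v
      using exact_propagator_in_Vh[OF uh(1) times(1) times(2) time_le, of n v] that \<open>0 < D\<close>
      by (simp add: \<H>_def V_def over_coarse_def)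
    \<comment> \<open>The restriction of the semi-discrete solution to a coarse interval is a
      solution there, so the exact propagator carries it from one coarse point to the next.\<close>
    have H_u: "\<H> \<delta> n (u n) = u (Suc n)" if "n < N" for n
      using exact_propagator_eq[OF semidiscrete_solution_subinterval[OF uh(1) times(1) time_le] times(2), of n]
        that \<open>0 < D\<close> by (simp add: \<H>_def u_def over_coarse_def)
    have F_V: "\<F>M \<delta> n v \<in> V \<delta>" if "n < N" "v \<in> V \<delta>" for n v
      unfolding \<F>M_def using that assms(17) \<delta>
      by (intro fine_propagator_closed) (auto simp: N_def)
    have U0: "U 0 = u 0" by (simp add: U_def u_def time uh)
    \<comment> \<open>Here \<open>n < N \<le> k\<close>, so the iterates follow the sequential fine
      scheme.\<close>
    have U_Suc: "U (Suc n) = \<F>M \<delta> n (U n)" if "n < N" for n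
      using that k unfolding U_def N_def by (intro parareal_eq_fine) simp
    have UV: "U n \<in> V \<delta>" if "n \<le> N" for n
      using that
    proof (induction n)
      case 0
      then show ?case using uV[of 0] by (simp add: U0)
    next
      case (Suc n)
      then show ?case by (simp add: U_Suc F_V)
    qed
    \<comment> \<open>Condition 3 with both coarse arguments equal to \<open>w\<close>: the coarse
      values cancel, which leaves a Lipschitz bound for the exact propagator.\<close>
    have stable: "L2_norm \<Omega> (\<H> \<delta> n w - \<H> \<delta> n \<xi>) \<le> (1 + K * \<tau>) * L2_norm \<Omega> (w - \<xi>)"
      if "n < N" "w \<in> V \<delta>" "\<xi> \<in> V \<delta>" for n w \<xi>
    proof -
      let ?e = "L2_norm \<Omega> (w - \<xi>)"
      have "?e \<ge> 0" using that by (simp add: \<Omega>_def V_def L2_norm_nonneg Vh_diff)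
      have "\<tau> ^ (p + 1) \<le> T ^ p * \<tau>"
        using \<tau> power_mono[of \<tau> T p] by simp
      then have "C3 * (\<tau> * ?e + \<tau> ^ (p + 1) * ?e) \<le> C3 * (\<tau> * ?e + T ^ p * \<tau> * ?e)"
        using \<open>C3 > 0\<close> \<open>?e \<ge> 0\<close> by (intro mult_left_mono add_left_mono mult_right_mono) auto
      also have "\<dots> = K * \<tau> * ?e" by (simp add: K_def algebra_simps)
      finally show ?thesis
        using C3[of \<delta> w w \<xi> n] that \<delta> by (simp add: \<tau>_def N_def distrib_right)
    qed
    define err where "err n = L2_norm \<Omega> (U n - u n)" for n
    have step: "err (Suc n) \<le> (1 + K * \<tau>) * err n + C1 * fine_step T \<delta> ^ (q + 1)" if "n < N" for n
    proof -
      have V: "\<F>M \<delta> n (U n) \<in> V \<delta>" "\<H> \<delta> n (U n) \<in> V \<delta>" "\<H> \<delta> n (u n) \<in> V \<delta>"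
        using that UV uV F_V H_V by simp_all
      \<comment> \<open>The local error of the fine propagator plus the earlier error transported by
        the exact one.\<close>
      have "U (Suc n) - u (Suc n) = (\<F>M \<delta> n (U n) - \<H> \<delta> n (U n)) + (\<H> \<delta> n (U n) - \<H> \<delta> n (u n))"
        using that by (simp add: U_Suc H_u)
      then have "err (Suc n) \<le> L2_norm \<Omega> (\<F>M \<delta> n (U n) - \<H> \<delta> n (U n)) + L2_norm \<Omega> (\<H> \<delta> n (U n) - \<H> \<delta> n (u n))"
        using V unfolding err_def \<Omega>_def V_def by (simp only:) (intro L2_norm_triangle Vh_diff)
      moreover have "L2_norm \<Omega> (\<F>M \<delta> n (U n) - \<H> \<delta> n (U n)) \<le> C1 * fine_step T \<delta> ^ (q + 1)"
        using that UV[of n] by (intro order_trans[OF Max_ge C1[OF \<delta>]]) (auto simp: N_def)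
      moreover have "L2_norm \<Omega> (\<H> \<delta> n (U n) - \<H> \<delta> n (u n)) \<le> (1 + K * \<tau>) * err n"
        unfolding err_def using that UV uV by (intro stable) auto
      ultimately show ?thesis by linarith
    qed
    have dt: "0 < fine_step T \<delta>" "real N * fine_step T \<delta> \<le> T"
      using valid \<open>0 < T\<close>
      by (auto simp: fine_step_def N_def valid_discretization_def field_simps)
    have "err 0 = 0" by (simp add: err_def U0 L2_norm_def L2_inner_def)
    then have "err n \<le> real n * (C1 * fine_step T \<delta> ^ (q + 1)) * exp (real n * (K * \<tau>))"
      using step \<open>K > 0\<close> \<open>C1 > 0\<close> \<tau>(1) dt(1) n
      by (intro discrete_Gronwall[where N = N]) (auto simp: N_def)
    also have "\<dots> \<le> real N * (C1 * fine_step T \<delta> ^ (q + 1)) * exp (real N * (K * \<tau>))"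
      using n \<open>K > 0\<close> \<open>C1 > 0\<close> \<tau>(1) dt(1) by (intro mult_mono) (auto simp: N_def)
    \<comment> \<open>One of the \<open>q + 1\<close> factors of the fine step is paired with the
      number \<open>N\<close> of steps, which costs one order.\<close>
    also have "\<dots> = C1 * (real N * fine_step T \<delta>) * exp (K * T) * fine_step T \<delta> ^ q"
      unfolding \<tau>(3)[symmetric] by (simp add: mult_ac)
    also have "\<dots> \<le> C1 * T * exp (K * T) * fine_step T \<delta> ^ q"
      using dt \<open>C1 > 0\<close> by (intro mult_right_mono mult_left_mono) auto
    finally show ?thesis by (simp add: err_def U_def u_def)
  qed
  have "C1 * T * exp (K * T) > 0" using \<open>C1 > 0\<close> \<open>0 < T\<close> by simp
  with bound show ?thesis by blast
qed

end
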